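(* Let $k$ be a field and let $H$ be a commutative, noetherian (in particular: finite dimensional), semisimple and cosemisimple Hopf algebra over $k$ with bijective antipode. Then each $M\in {}_{H}\mathcal{YD}^H$ is a direct sum in ${}_{H}\mathcal{YD}^H$ of a family of simple subobjects of $M$ that are finitely generated as $H$-modules. Hence $M$ is semisimple in ${}_{H}\mathcal{YD}^H$, and ${}_{H}\mathcal{YD}^H$ is a semisimple category.
   Context: Let $S$ denote the antipode of $H$; write $\Delta(h)=h_1\otimes h_2$ for the comultiplication and $\rho(m)=m_0\otimes m_1\in M\otimes H$ for a right $H$-coaction (summation understood). A (left-right) Yetter-Drinfeld module is a $k$-vector space $M$ that is a left $H$-module and a right $H$-comodule such that $h_1m_0\otimes h_2m_1=(h_2m)_0\otimes (h_2m)_1h_1$, equivalently $\rho(hm)=h_2m_0\otimes h_3m_1S^{-1}(h_1)$, for all $h\in H$, $m\in M$. ${}_{H}\mathcal{YD}^H$ is the category of Yetter-Drinfeld modules with $H$-linear $H$-colinear maps. "Semisimple" for $H$ means semisimple as an algebra, "cosemisimple" means cosemisimple as a coalgebra. An object of ${}_{H}\mathcal{YD}^H$ is simple if it is nonzero and has no subobjects in ${}_{H}\mathcal{YD}^H$ other than $0$ and itself; an object is semisimple if it is a direct sum of simple objects; the category is semisimple if every object is semisimple. *)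

theory Defs
  imports Complex_Main
begin

section \<open>Tensor products\<close>

text \<open>
  A finite formal sum of pure tensors is written as a list of tuples, so that Sweedler notation
  becomes a list comprehension.  Two lists denote the same element of the tensor product iff they
  are related by the congruence generated by commutativity of concatenation and by the usual
  (multi)linearity relations; the quotient is the tensor product.  Scalar factors can be moved into
  the first component and negatives are supplied by -1, so lists of pure tensors without
  coefficients suffice.
\<close>

inductive formal_sum_eq :: "('x list \<Rightarrow> 'x list \<Rightarrow> bool) \<Rightarrow> 'x list \<Rightarrow> 'x list \<Rightarrow> bool"
  for R where
  base: "R xs ys \<Longrightarrow> formal_sum_eq R xs ys"
| refl: "formal_sum_eq R xs xs"
| sym: "formal_sum_eq R xs ys \<Longrightarrow> formal_sum_eq R ys xs"
| trans: "formal_sum_eq R xs ys \<Longrightarrow> formal_sum_eq R ys zs \<Longrightarrow> formal_sum_eq R xs zs"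
| comm: "formal_sum_eq R (xs @ ys) (ys @ xs)"
| append: "formal_sum_eq R xs xs' \<Longrightarrow> formal_sum_eq R ys ys' \<Longrightarrow>
    formal_sum_eq R (xs @ ys) (xs' @ ys')"

inductive bilinear_rel ::
  "('k \<Rightarrow> 'v::ab_group_add \<Rightarrow> 'v) \<Rightarrow> ('k \<Rightarrow> 'w::ab_group_add \<Rightarrow> 'w) \<Rightarrow>
   ('v \<times> 'w) list \<Rightarrow> ('v \<times> 'w) list \<Rightarrow> bool"
  for s1 s2 where
  zero: "bilinear_rel s1 s2 [(0, w)] []"
| add1: "bilinear_rel s1 s2 [(v + v', w)] [(v, w), (v', w)]"
| add2: "bilinear_rel s1 s2 [(v, w + w')] [(v, w), (v, w')]"
| scale: "bilinear_rel s1 s2 [(s1 a v, w)] [(v, s2 a w)]"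

inductive trilinear_rel ::
  "('k \<Rightarrow> 'u::ab_group_add \<Rightarrow> 'u) \<Rightarrow> ('k \<Rightarrow> 'v::ab_group_add \<Rightarrow> 'v) \<Rightarrow>
   ('k \<Rightarrow> 'w::ab_group_add \<Rightarrow> 'w) \<Rightarrow>
   ('u \<times> 'v \<times> 'w) list \<Rightarrow> ('u \<times> 'v \<times> 'w) list \<Rightarrow> bool"
  for s1 s2 s3 where
  zero: "trilinear_rel s1 s2 s3 [(0, v, w)] []"
| add1: "trilinear_rel s1 s2 s3 [(u + u', v, w)] [(u, v, w), (u', v, w)]"
| add2: "trilinear_rel s1 s2 s3 [(u, v + v', w)] [(u, v, w), (u, v', w)]"
| add3: "trilinear_rel s1 s2 s3 [(u, v, w + w')] [(u, v, w), (u, v, w')]"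
| scale12: "trilinear_rel s1 s2 s3 [(s1 a u, v, w)] [(u, s2 a v, w)]"
| scale23: "trilinear_rel s1 s2 s3 [(u, s2 a v, w)] [(u, v, s3 a w)]"

definition tensor_eq where
  "tensor_eq s1 s2 = formal_sum_eq (bilinear_rel s1 s2)"

definition tensor3_eq where
  "tensor3_eq s1 s2 s3 = formal_sum_eq (trilinear_rel s1 s2 s3)"


section \<open>Direct sums and rings\<close>

text \<open>
  The ambient type is the internal direct sum of the family. Indexing a family of nonzero
  subspaces by itself is no restriction, since the summands of a direct sum are then distinct.
\<close>

definition is_direct_sum :: "'v::ab_group_add set set \<Rightarrow> bool" where
  "is_direct_sum \<N> \<longleftrightarrow>
     (\<forall>v. \<exists>!f. (\<forall>N\<in>\<N>. f N \<in> N) \<and> (\<forall>N. N \<notin> \<N> \<longrightarrow> f N = 0) \<and>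
        finite {N. f N \<noteq> 0} \<and> v = (\<Sum>N | f N \<noteq> 0. f N))"

definition (in module) finitely_generated :: "'b set \<Rightarrow> bool" where
  "finitely_generated N \<longleftrightarrow> (\<exists>F. finite F \<and> N = span F)"

definition (in module) simple_submodule :: "'b set \<Rightarrow> bool" where
  "simple_submodule N \<longleftrightarrow> subspace N \<and> N \<noteq> {0} \<and>
     (\<forall>L. subspace L \<and> L \<subseteq> N \<longrightarrow> L = {0} \<or> L = N)"

definition (in module) semisimple_module :: bool where
  "semisimple_module \<longleftrightarrow> (\<exists>\<N>. (\<forall>N\<in>\<N>. simple_submodule N) \<and> is_direct_sum \<N>)"

definition noetherian_ring :: "'r::comm_ring_1 itself \<Rightarrow> bool" where
  "noetherian_ring _ \<longleftrightarrow>
     (\<forall>I :: 'r set. module.subspace (*) I \<longrightarrow> module.finitely_generated (*) I)"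

definition semisimple_ring :: "'r::comm_ring_1 itself \<Rightarrow> bool" where
  "semisimple_ring _ \<longleftrightarrow> module.semisimple_module ((*) :: 'r \<Rightarrow> 'r \<Rightarrow> 'r)"


section \<open>Coalgebras and Hopf algebras\<close>

text \<open>
  Structure maps with values in a tensor product are given by a choice of representing formal
  sums; all axioms are stated modulo equality in the tensor product and hence do not depend on
  this choice.
\<close>

locale coalgebra = vector_space scale
  for scale :: "'k::field \<Rightarrow> 'c::ab_group_add \<Rightarrow> 'c" +
  fixes \<Delta> :: "'c \<Rightarrow> ('c \<times> 'c) list"
    and \<epsilon> :: "'c \<Rightarrow> 'k"
  assumes comult_add: "tensor_eq scale scale (\<Delta> (x + y)) (\<Delta> x @ \<Delta> y)"
    and comult_scale:
      "tensor_eq scale scale (\<Delta> (scale a x)) [(scale a u, v). (u, v) \<leftarrow> \<Delta> x]"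
    and counit_linear: "Vector_Spaces.linear scale (*) \<epsilon>"
    and coassoc:
      "tensor3_eq scale scale scale
         [(p, q, v). (u, v) \<leftarrow> \<Delta> x, (p, q) \<leftarrow> \<Delta> u]
         [(u, p, q). (u, v) \<leftarrow> \<Delta> x, (p, q) \<leftarrow> \<Delta> v]"
    and counit_left: "(\<Sum>(u, v) \<leftarrow> \<Delta> x. scale (\<epsilon> u) v) = x"
    and counit_right: "(\<Sum>(u, v) \<leftarrow> \<Delta> x. scale (\<epsilon> v) u) = x"
begin

definition subcoalgebra :: "'c set \<Rightarrow> bool" where
  "subcoalgebra D \<longleftrightarrow> subspace D \<and>
     (\<forall>x\<in>D. \<exists>ys. set ys \<subseteq> D \<times> D \<and> tensor_eq scale scale (\<Delta> x) ys)"

definition simple_subcoalgebra :: "'c set \<Rightarrow> bool" where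
  "simple_subcoalgebra D \<longleftrightarrow> subcoalgebra D \<and> D \<noteq> {0} \<and>
     (\<forall>E. subcoalgebra E \<and> E \<subseteq> D \<longrightarrow> E = {0} \<or> E = D)"

definition cosemisimple :: bool where
  "cosemisimple \<longleftrightarrow> (\<exists>\<D>. (\<forall>D\<in>\<D>. simple_subcoalgebra D) \<and> is_direct_sum \<D>)"

end

locale hopf_algebra = coalgebra scale \<Delta> \<epsilon>
  for scale :: "'k::field \<Rightarrow> 'h::ring_1 \<Rightarrow> 'h"
    and \<Delta> :: "'h \<Rightarrow> ('h \<times> 'h) list"
    and \<epsilon> :: "'h \<Rightarrow> 'k" +
  fixes S :: "'h \<Rightarrow> 'h"
  assumes scale_mult_left: "scale a x * y = scale a (x * y)"
    and scale_mult_right: "x * scale a y = scale a (x * y)"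
    and comult_mult:
      "tensor_eq scale scale (\<Delta> (x * y))
         [(u * u', v * v'). (u, v) \<leftarrow> \<Delta> x, (u', v') \<leftarrow> \<Delta> y]"
    and comult_one: "tensor_eq scale scale (\<Delta> 1) [(1, 1)]"
    and counit_mult: "\<epsilon> (x * y) = \<epsilon> x * \<epsilon> y"
    and counit_one: "\<epsilon> 1 = 1"
    and antipode_linear: "Vector_Spaces.linear scale scale S"
    and antipode_left: "(\<Sum>(u, v) \<leftarrow> \<Delta> x. S u * v) = scale (\<epsilon> x) 1"
    and antipode_right: "(\<Sum>(u, v) \<leftarrow> \<Delta> x. u * S v) = scale (\<epsilon> x) 1"


section \<open>Yetter-Drinfeld modules\<close>

locale right_comodule = C: coalgebra scale \<Delta> \<epsilon> + V: vector_space scaleM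
  for scale :: "'k::field \<Rightarrow> 'c::ab_group_add \<Rightarrow> 'c"
    and \<Delta> :: "'c \<Rightarrow> ('c \<times> 'c) list"
    and \<epsilon> :: "'c \<Rightarrow> 'k"
    and scaleM :: "'k \<Rightarrow> 'm::ab_group_add \<Rightarrow> 'm" +
  fixes \<rho> :: "'m \<Rightarrow> ('m \<times> 'c) list"
  assumes coact_add: "tensor_eq scaleM scale (\<rho> (m + n)) (\<rho> m @ \<rho> n)"
    and coact_scale:
      "tensor_eq scaleM scale (\<rho> (scaleM a m)) [(scaleM a m0, m1). (m0, m1) \<leftarrow> \<rho> m]"
    and coact_coassoc:
      "tensor3_eq scaleM scale scale
         [(p, q, m1). (m0, m1) \<leftarrow> \<rho> m, (p, q) \<leftarrow> \<rho> m0]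
         [(m0, p, q). (m0, m1) \<leftarrow> \<rho> m, (p, q) \<leftarrow> \<Delta> m1]"
    and coact_counit: "(\<Sum>(m0, m1) \<leftarrow> \<rho> m. scaleM (\<epsilon> m1) m0) = m"
begin

definition subcomodule :: "'m set \<Rightarrow> bool" where
  "subcomodule N \<longleftrightarrow> V.subspace N \<and>
     (\<forall>n\<in>N. \<exists>ys. set ys \<subseteq> N \<times> UNIV \<and> tensor_eq scaleM scale (\<rho> n) ys)"

end

text \<open>
  The compatibility axiom reads
  \<open>h\<^sub>1 m\<^sub>0 \<otimes> h\<^sub>2 m\<^sub>1 = (h\<^sub>2 m)\<^sub>0 \<otimes> (h\<^sub>2 m)\<^sub>1 h\<^sub>1\<close>.
\<close>

locale yetter_drinfeld_module =
  H: hopf_algebra scale \<Delta> \<epsilon> S + right_comodule scale \<Delta> \<epsilon> scaleM \<rho> + A: module act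
  for scale :: "'k::field \<Rightarrow> 'h::comm_ring_1 \<Rightarrow> 'h"
    and \<Delta> :: "'h \<Rightarrow> ('h \<times> 'h) list"
    and \<epsilon> :: "'h \<Rightarrow> 'k"
    and S :: "'h \<Rightarrow> 'h"
    and scaleM :: "'k \<Rightarrow> 'm::ab_group_add \<Rightarrow> 'm"
    and act :: "'h \<Rightarrow> 'm \<Rightarrow> 'm"
    and \<rho> :: "'m \<Rightarrow> ('m \<times> 'h) list" +
  assumes act_scale: "act (scale a h) m = scaleM a (act h m)"
    and yetter_drinfeld:
      "tensor_eq scaleM scale
         [(act h1 m0, h2 * m1). (h1, h2) \<leftarrow> \<Delta> h, (m0, m1) \<leftarrow> \<rho> m]
         [(m0, m1 * h1). (h1, h2) \<leftarrow> \<Delta> h, (m0, m1) \<leftarrow> \<rho> (act h2 m)]"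
begin

definition subobject :: "'m set \<Rightarrow> bool" where
  "subobject N \<longleftrightarrow> A.subspace N \<and> subcomodule N"

text \<open>
  Since tensoring over a field is exact, a subobject \<open>N\<close> is itself a Yetter-Drinfeld module in a
  unique way, and its subobjects are the subobjects of the ambient module contained in \<open>N\<close>.
\<close>

definition simple_subobject :: "'m set \<Rightarrow> bool" where
  "simple_subobject N \<longleftrightarrow> subobject N \<and> N \<noteq> {0} \<and>
     (\<forall>L. subobject L \<and> L \<subseteq> N \<longrightarrow> L = {0} \<or> L = N)"

definition semisimple_object :: bool where
  "semisimple_object \<longleftrightarrow> (\<exists>\<N>. (\<forall>N\<in>\<N>. simple_subobject N) \<and> is_direct_sum \<N>)"

end

text \<open>
  The objects of the category are the Yetter-Drinfeld module structures on the type \<open>'m\<close>, which is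
  a free type variable.
\<close>

definition yd_category_semisimple ::
  "('k::field \<Rightarrow> 'h::comm_ring_1 \<Rightarrow> 'h) \<Rightarrow> ('h \<Rightarrow> ('h \<times> 'h) list) \<Rightarrow> ('h \<Rightarrow> 'k) \<Rightarrow>
   ('h \<Rightarrow> 'h) \<Rightarrow> 'm::ab_group_add itself \<Rightarrow> bool" where
  "yd_category_semisimple scale \<Delta> \<epsilon> S _ \<longleftrightarrow>
     (\<forall>(scaleM :: 'k \<Rightarrow> 'm \<Rightarrow> 'm) act \<rho>.
        yetter_drinfeld_module scale \<Delta> \<epsilon> S scaleM act \<rho> \<longrightarrow>
        yetter_drinfeld_module.semisimple_object scale scaleM act \<rho>)"

end

theory Submission
  imports Defs
begin

text \<open>
  Semisimplicity of \<open>H\<close> gives an integral \<open>t \<in> H\<close> with \<open>h t = \<epsilon>(h) t\<close> and \<open>\<epsilon>(t) = 1\<close>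
  (\<open>normalized_integral\<close>), and cosemisimplicity gives a functional \<open>\<phi>\<close> on \<open>H\<close> with
  \<open>\<phi>(h\<^sub>2) h\<^sub>1 = \<phi>(h) 1\<close> and \<open>\<phi>(1) = 1\<close> (\<open>normalized_cointegral\<close>). As in the proof of Maschke's theorem,
  these are used to average a linear projection \<open>q\<close> of a Yetter-Drinfeld module \<open>M\<close> onto a subobject
  \<open>N\<close>, in two steps: \<open>p(m) = t\<^sub>1 q(S(t\<^sub>2) m)\<close> is an \<open>H\<close>-linear projection, and
  \<open>P(m) = \<phi>(p(m\<^sub>0)\<^sub>1 S(m\<^sub>1)) p(m\<^sub>0)\<^sub>0\<close> is in addition colinear (\<open>exists_yetter_drinfeld_projection\<close>).
  That the second step does not destroy \<open>H\<close>-linearity is where commutativity of \<open>H\<close> matters. So each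
  subobject has a complement, the kernel of \<open>P\<close>.

  A subgroup of \<open>M\<close> is a subobject iff it is stable under the action of \<open>H\<close> and under the operators
  \<open>m \<mapsto> f(m\<^sub>1) m\<^sub>0\<close> for linear functionals \<open>f\<close> on \<open>H\<close> (\<open>subobject_iff\<close>). For abelian groups with a set of
  operators, complements of all stable subgroups imply, by two applications of Zorn's lemma, that the
  group is a direct sum of simple stable subgroups (\<open>direct_sum_of_simple\<close>).

  Finally, an element \<open>x\<close> of a simple subobject generates a finite-dimensional subcomodule, and the
  \<open>H\<close>-submodule generated by a subcomodule is a subobject, because
  \<open>\<rho>(h m) = h\<^sub>2 m\<^sub>0 \<otimes> h\<^sub>3 m\<^sub>1 S(h\<^sub>1)\<close>. For \<open>x \<noteq> 0\<close> it is the whole simple subobject, which is therefore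
  finitely generated over \<open>H\<close> (\<open>simple_subobject_finitely_generated\<close>).

  Coproducts and coactions are given by representatives, and equations between tensors are
  exploited by applying multilinear maps to both sides. The resulting calculations in Sweedler
  notation use nested sums \<open>sweedler\<close> and \<open>cosweedler\<close>.
\<close>

section \<open>Abelian groups with operators\<close>

text \<open>
  Subobjects of a Yetter-Drinfeld module turn out to be exactly the subgroups stable under a set
  of additive operators, so the passage from complements to a direct sum of simple subobjects only
  has to be made for abelian groups with operators.
\<close>

locale operator_group =
  fixes \<Omega> :: "('m::ab_group_add \<Rightarrow> 'm) set"
  assumes operator_add: "\<omega> \<in> \<Omega> \<Longrightarrow> \<omega> (x + y) = \<omega> x + \<omega> y"
begin

definition stable :: "'m set \<Rightarrow> bool" where
  "stable N \<longleftrightarrow> 0 \<in> N \<and> (\<forall>x\<in>N. \<forall>y\<in>N. x - y \<in> N) \<and> (\<forall>\<omega>\<in>\<Omega>. \<forall>x\<in>N. \<omega> x \<in> N)"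

definition simple_stable :: "'m set \<Rightarrow> bool" where
  "simple_stable N \<longleftrightarrow> stable N \<and> N \<noteq> {0} \<and> (\<forall>L. stable L \<and> L \<subseteq> N \<longrightarrow> L = {0} \<or> L = N)"

text \<open>
  Independence is tested on finite subfamilies, so that it passes to unions of chains.
\<close>

definition independent_family :: "'m set set \<Rightarrow> bool" where
  "independent_family \<N> \<longleftrightarrow>
     (\<forall>F f. finite F \<and> F \<subseteq> \<N> \<and> (\<forall>N\<in>F. f N \<in> N) \<and> sum f F = 0 \<longrightarrow> (\<forall>N\<in>F. f N = 0))"

definition family_sum :: "'m set set \<Rightarrow> 'm set" where
  "family_sum \<N> = {sum f F | f F. finite F \<and> F \<subseteq> \<N> \<and> (\<forall>N\<in>F. f N \<in> N)}"

lemma stable_zero: "stable N \<Longrightarrow> 0 \<in> N"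
  and stable_diff: "stable N \<Longrightarrow> x \<in> N \<Longrightarrow> y \<in> N \<Longrightarrow> x - y \<in> N"
  and stable_operator: "stable N \<Longrightarrow> \<omega> \<in> \<Omega> \<Longrightarrow> x \<in> N \<Longrightarrow> \<omega> x \<in> N"
  by (auto simp: stable_def)

lemma stable_uminus: "stable N \<Longrightarrow> x \<in> N \<Longrightarrow> - x \<in> N"
  using stable_diff[of N 0 x] by (simp add: stable_zero)

lemma stable_add: "stable N \<Longrightarrow> x \<in> N \<Longrightarrow> y \<in> N \<Longrightarrow> x + y \<in> N"
  using stable_diff[of N x "- y"] by (simp add: stable_uminus)

lemma stable_if: "stable N \<Longrightarrow> (P \<Longrightarrow> x \<in> N) \<Longrightarrow> (if P then x else 0) \<in> N"
  by (simp add: stable_zero)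

lemma operator_zero: "\<omega> \<in> \<Omega> \<Longrightarrow> \<omega> 0 = 0"
  using operator_add[of \<omega> 0 0] by simp

lemma operator_sum: "\<omega> \<in> \<Omega> \<Longrightarrow> \<omega> (sum f I) = (\<Sum>i\<in>I. \<omega> (f i))"
  by (induction I rule: infinite_finite_induct) (auto simp: operator_zero operator_add)

lemma stable_singleton_zero: "stable {0}"
  by (auto simp: stable_def operator_zero)

lemma stable_Int: "stable K \<Longrightarrow> stable L \<Longrightarrow> stable (K \<inter> L)"
  by (auto simp: stable_def)

lemma stable_plus:
  assumes "stable K" "stable L"
  shows "stable {x + y | x y. x \<in> K \<and> y \<in> L}"
  unfolding stable_def
proof (intro conjI ballI)
  show "0 \<in> {x + y |x y. x \<in> K \<and> y \<in> L}"
    using assms stable_zero by force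
next
  fix u v
  assume "u \<in> {x + y |x y. x \<in> K \<and> y \<in> L}" "v \<in> {x + y |x y. x \<in> K \<and> y \<in> L}"
  then obtain x y x' y' where "u = x + y" "v = x' + y'" "x \<in> K" "x' \<in> K" "y \<in> L" "y' \<in> L"
    by auto
  then have "u - v = (x - x') + (y - y')" "x - x' \<in> K" "y - y' \<in> L"
    using assms by (auto simp: stable_diff)
  then show "u - v \<in> {x + y |x y. x \<in> K \<and> y \<in> L}"
    by blast
next
  fix \<omega> u
  assume "\<omega> \<in> \<Omega>" "u \<in> {x + y |x y. x \<in> K \<and> y \<in> L}"
  then show "\<omega> u \<in> {x + y |x y. x \<in> K \<and> y \<in> L}"
    using assms by (force simp: operator_add intro: stable_operator)
qed

lemma stable_chain_Union:
  assumes "C \<noteq> {}" "subset.chain {K. stable K \<and> P K} C"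
  shows "stable (\<Union>C)"
proof -
  have st: "stable K" if "K \<in> C" for K
    using assms(2) that by (auto simp: subset.chain_def)
  have "x - y \<in> \<Union>C" if x: "x \<in> \<Union>C" and y: "y \<in> \<Union>C" for x y
  proof -
    obtain K L where KL: "K \<in> C" "x \<in> K" "L \<in> C" "y \<in> L"
      using x y by auto
    then have "K \<subseteq> L \<or> L \<subseteq> K"
      using assms(2) by (auto simp: subset.chain_def)
    then show ?thesis
      using KL st[of K] st[of L] by (meson Union_iff stable_diff subsetD)
  qed
  moreover have "0 \<in> \<Union>C"
    using assms(1) st stable_zero by blast
  ultimately show ?thesis
    unfolding stable_def using st stable_operator by blast
qed

lemma sum_diff_common_support:
  fixes f g :: "'i \<Rightarrow> 'm"
  assumes "finite F" "finite G"
  shows "sum f F - sum g G =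
    (\<Sum>N\<in>F \<union> G. (if N \<in> F then f N else 0) - (if N \<in> G then g N else 0))"
proof -
  have "sum f F = (\<Sum>N\<in>F \<union> G. if N \<in> F then f N else 0)"
    by (rule sum.mono_neutral_cong_left) (use assms in auto)
  moreover have "sum g G = (\<Sum>N\<in>F \<union> G. if N \<in> G then g N else 0)"
    by (rule sum.mono_neutral_cong_left) (use assms in auto)
  ultimately show ?thesis
    by (simp add: sum_subtractf)
qed

lemma family_sumI:
  "finite F \<Longrightarrow> F \<subseteq> \<N> \<Longrightarrow> (\<And>N. N \<in> F \<Longrightarrow> f N \<in> N) \<Longrightarrow> sum f F \<in> family_sum \<N>"
  unfolding family_sum_def by blast

lemma stable_family_sum:
  assumes "\<And>N. N \<in> \<N> \<Longrightarrow> stable N"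
  shows "stable (family_sum \<N>)"
  unfolding stable_def
proof (intro conjI ballI)
  show "0 \<in> family_sum \<N>"
    using family_sumI[of "{}"] by simp
next
  fix x y assume "x \<in> family_sum \<N>" "y \<in> family_sum \<N>"
  then obtain f F g G where
    F: "finite F" "F \<subseteq> \<N>" "\<forall>N\<in>F. f N \<in> N" "x = sum f F" and
    G: "finite G" "G \<subseteq> \<N>" "\<forall>N\<in>G. g N \<in> N" "y = sum g G"
    unfolding family_sum_def by blast
  define h where "h N = (if N \<in> F then f N else 0) - (if N \<in> G then g N else 0)" for N
  have mem: "h N \<in> N" if "N \<in> F \<union> G" for N
  proof -
    have st: "stable N" using that F(2) G(2) assms by blast
    have "(if N \<in> F then f N else 0) \<in> N" "(if N \<in> G then g N else 0) \<in> N"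
      by (rule stable_if[OF st], rule bspec[OF F(3)] bspec[OF G(3)], assumption)+
    then show ?thesis
      unfolding h_def by (rule stable_diff[OF st])
  qed
  have "x - y = sum h (F \<union> G)"
    unfolding F(4) G(4) sum_diff_common_support[OF F(1) G(1)] h_def ..
  moreover have "sum h (F \<union> G) \<in> family_sum \<N>"
    by (rule family_sumI) (use F(1,2) G(1,2) mem in blast)+
  ultimately show "x - y \<in> family_sum \<N>"
    by argo
next
  fix \<omega> x assume \<omega>: "\<omega> \<in> \<Omega>" and "x \<in> family_sum \<N>"
  then obtain f F where F: "finite F" "F \<subseteq> \<N>" "\<forall>N\<in>F. f N \<in> N" "x = sum f F"
    unfolding family_sum_def by blast
  have "\<omega> (f N) \<in> N" if "N \<in> F" for N
    using that F(2) bspec[OF F(3) that] by (intro stable_operator[OF assms \<omega>]) auto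
  then have "(\<Sum>N\<in>F. \<omega> (f N)) \<in> family_sum \<N>"
    by (rule family_sumI[OF F(1,2)])
  then show "\<omega> x \<in> family_sum \<N>"
    unfolding F(4) operator_sum[OF \<omega>] .
qed

lemma family_sum_superset: "N \<in> \<N> \<Longrightarrow> N \<subseteq> family_sum \<N>"
  using family_sumI[of "{N}" \<N> "\<lambda>_. x" for x] by auto

lemma independent_familyD:
  assumes "independent_family \<N>" "finite F" "F \<subseteq> \<N>" "\<And>N. N \<in> F \<Longrightarrow> f N \<in> N" "sum f F = 0"
  shows "\<forall>N\<in>F. f N = 0"
proof -
  have "finite F \<and> F \<subseteq> \<N> \<and> (\<forall>N\<in>F. f N \<in> N) \<and> sum f F = 0"
    by (intro conjI ballI assms(2-5))
  with assms(1)[unfolded independent_family_def, THEN spec, THEN spec, of F f] show ?thesis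
    by (rule mp)
qed

lemma is_direct_sum_if_independent:
  assumes st: "\<And>N. N \<in> \<N> \<Longrightarrow> stable N" and ind: "independent_family \<N>"
    and span: "family_sum \<N> = UNIV"
  shows "is_direct_sum \<N>"
  unfolding is_direct_sum_def
proof (intro allI ex_ex1I)
  fix v
  have "v \<in> family_sum \<N>"
    using span by simp
  then obtain f F where F: "finite F" "F \<subseteq> \<N>" "\<forall>N\<in>F. f N \<in> N" "v = sum f F"
    unfolding family_sum_def by blast
  define g where "g N = (if N \<in> F then f N else 0)" for N
  have "sum g {N. g N \<noteq> 0} = sum f F"
    by (rule sum.mono_neutral_cong_left) (auto simp: g_def F)
  moreover have "finite {N. g N \<noteq> 0}"
    by (rule finite_subset[OF _ F(1)]) (auto simp: g_def)
  moreover have "g N \<in> N" if "N \<in> \<N>" for N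
    unfolding g_def by (rule stable_if[OF st[OF that] bspec[OF F(3)]])
  moreover have "\<forall>N. N \<notin> \<N> \<longrightarrow> g N = 0"
    using F(2) by (auto simp: g_def)
  ultimately show "\<exists>f. (\<forall>N\<in>\<N>. f N \<in> N) \<and> (\<forall>N. N \<notin> \<N> \<longrightarrow> f N = 0) \<and>
      finite {N. f N \<noteq> 0} \<and> v = sum f {N. f N \<noteq> 0}"
    unfolding F(4) by metis
next
  fix v f g
  assume "(\<forall>N\<in>\<N>. f N \<in> N) \<and> (\<forall>N. N \<notin> \<N> \<longrightarrow> f N = 0) \<and>
      finite {N. f N \<noteq> 0} \<and> v = sum f {N. f N \<noteq> 0}"
  then have f: "\<And>N. N \<in> \<N> \<Longrightarrow> f N \<in> N" "\<And>N. f N \<noteq> 0 \<Longrightarrow> N \<in> \<N>"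
      "finite {N. f N \<noteq> 0}" "sum f {N. f N \<noteq> 0} = v"
    by blast+
  assume "(\<forall>N\<in>\<N>. g N \<in> N) \<and> (\<forall>N. N \<notin> \<N> \<longrightarrow> g N = 0) \<and>
      finite {N. g N \<noteq> 0} \<and> v = sum g {N. g N \<noteq> 0}"
  then have g: "\<And>N. N \<in> \<N> \<Longrightarrow> g N \<in> N" "\<And>N. g N \<noteq> 0 \<Longrightarrow> N \<in> \<N>"
      "finite {N. g N \<noteq> 0}" "sum g {N. g N \<noteq> 0} = v"
    by blast+
  let ?U = "{N. f N \<noteq> 0} \<union> {N. g N \<noteq> 0}"
  have U: "finite ?U" "?U \<subseteq> \<N>"
    using f(2,3) g(2,3) by auto
  have "(\<Sum>N\<in>?U. f N - g N) = (\<Sum>N\<in>?U. f N) - (\<Sum>N\<in>?U. g N)"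
    by (rule sum_subtractf)
  also have "(\<Sum>N\<in>?U. f N) = v"
    unfolding f(4)[symmetric] by (rule sum.mono_neutral_right) (use U in auto)
  also have "(\<Sum>N\<in>?U. g N) = v"
    unfolding g(4)[symmetric] by (rule sum.mono_neutral_right) (use U in auto)
  finally have sum0: "(\<Sum>N\<in>?U. f N - g N) = 0"
    by simp
  have mem: "f N - g N \<in> N" if "N \<in> ?U" for N
  proof -
    have "N \<in> \<N>" using that U by blast
    then show ?thesis using f(1) g(1) st stable_diff by blast
  qed
  have "\<forall>N\<in>?U. f N - g N = 0"
    by (rule independent_familyD[OF ind U mem sum0])
  then have "f N = g N" for N
    by (metis (mono_tags, lifting) UnCI mem_Collect_eq right_minus_eq)
  then show "f = g" by (rule ext)
qed

end

locale complemented_operator_group = operator_group +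
  assumes complement: "stable N \<Longrightarrow>
    \<exists>K. stable K \<and> N \<inter> K = {0} \<and> (\<forall>x. \<exists>n\<in>N. \<exists>k\<in>K. x = n + k)"
begin

text \<open>
  Take \<open>x \<noteq> 0\<close> in \<open>N\<close> and a stable \<open>K \<subseteq> N\<close> that is maximal among those avoiding \<open>x\<close>. Every
  stable subgroup of \<open>N\<close> strictly above \<open>K\<close> contains \<open>x\<close>. A proper nonzero piece \<open>L\<close> of a complement
  \<open>A\<close> of \<open>K\<close> in \<open>N\<close> would have a complement \<open>L'\<close> in \<open>A\<close>, and then \<open>x\<close> would lie in
  \<open>(K + L) \<inter> (K + L') = K\<close>; so \<open>A\<close> is simple.
\<close>

lemma simple_stable_below:
  assumes N: "stable N" "N \<noteq> {0}"
  obtains A where "simple_stable A" "A \<subseteq> N"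
proof -
  obtain x where x: "x \<in> N" "x \<noteq> 0"
    using N stable_zero by blast
  let ?Z = "{K. stable K \<and> K \<subseteq> N \<and> x \<notin> K}"
  have "\<exists>K\<in>?Z. \<forall>X\<in>?Z. K \<subseteq> X \<longrightarrow> X = K"
  proof (rule subset_Zorn_nonempty)
    have "{0} \<in> ?Z"
      using x stable_singleton_zero stable_zero[OF N(1)] by simp
    then show "?Z \<noteq> {}" by blast
    fix C assume "C \<noteq> {}" and C: "subset.chain ?Z C"
    then have "stable (\<Union>C)"
      by (rule stable_chain_Union)
    with C show "\<Union>C \<in> ?Z"
      by (auto simp: subset.chain_def)
  qed
  then obtain K where "K \<in> ?Z" and "\<forall>X\<in>?Z. K \<subseteq> X \<longrightarrow> X = K" ..
  then have K: "stable K" "K \<subseteq> N" "x \<notin> K"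
    and max: "\<And>X. stable X \<Longrightarrow> X \<subseteq> N \<Longrightarrow> x \<notin> X \<Longrightarrow> K \<subseteq> X \<Longrightarrow> X = K"
    by simp_all
  obtain K' where K': "stable K'" "K \<inter> K' = {0}" "\<And>y. \<exists>n\<in>K. \<exists>k\<in>K'. y = n + k"
    using complement[OF K(1)] by blast
  define A where "A = N \<inter> K'"
  have A: "stable A" "A \<subseteq> N" "K \<inter> A = {0}"
    unfolding A_def using N K K' by (auto simp: stable_Int stable_zero)
  have "A \<noteq> {0}"
  proof -
    obtain n k where nk: "n \<in> K" "k \<in> K'" "x = n + k"
      using K' by blast
    then have "k = x - n" by simp
    then have "k \<in> N" using x nk K N stable_diff by blast
    moreover have "k \<noteq> 0" using nk K by auto
    ultimately show ?thesis using nk A_def by blast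
  qed
  have x_in: "\<exists>k\<in>K. \<exists>l\<in>L. x = k + l" if L: "stable L" "L \<subseteq> A" "L \<noteq> {0}" for L
  proof (rule ccontr)
    let ?X = "{k + l | k l. k \<in> K \<and> l \<in> L}"
    assume "\<not> (\<exists>k\<in>K. \<exists>l\<in>L. x = k + l)"
    then have "x \<notin> ?X" by blast
    moreover have "stable ?X" using L K stable_plus by blast
    moreover have "?X \<subseteq> N"
      using K(2) L(2) A(2) by (auto intro!: stable_add[OF N(1)])
    moreover have "K \<subseteq> ?X" using stable_zero[OF L(1)] by force
    ultimately have "?X = K" using max by simp
    moreover have "L \<subseteq> ?X" using stable_zero[OF K(1)] by force
    ultimately have "L \<subseteq> {0}" using L(2) A(3) by auto
    then show False using L(3) stable_zero[OF L(1)] by auto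
  qed
  have "L = {0} \<or> L = A" if L: "stable L" "L \<subseteq> A" for L
  proof (rule ccontr)
    assume neg: "\<not> (L = {0} \<or> L = A)"
    obtain L' where L': "stable L'" "L \<inter> L' = {0}" "\<And>y. \<exists>n\<in>L. \<exists>k\<in>L'. y = n + k"
      using complement[OF L(1)] by blast
    obtain c where c: "c \<in> A" "c \<notin> L" using neg L by blast
    obtain n k where nk: "n \<in> L" "k \<in> L'" "c = n + k" using L' by blast
    then have "k = c - n" by simp
    then have "k \<in> A" using c nk L A stable_diff by blast
    moreover have "k \<noteq> 0" using nk c by auto
    ultimately have "L' \<inter> A \<noteq> {0}" using nk by blast
    then obtain k2 l2 where 2: "k2 \<in> K" "l2 \<in> L' \<inter> A" "x = k2 + l2"
      using x_in[of "L' \<inter> A"] stable_Int L' A by blast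
    obtain k1 l1 where 1: "k1 \<in> K" "l1 \<in> L" "x = k1 + l1"
      using x_in[of L] L neg by blast
    have "k1 - k2 = l2 - l1" using 1 2 by (simp add: algebra_simps)
    moreover have "k1 - k2 \<in> K" using 1 2 K stable_diff by blast
    moreover have "l2 - l1 \<in> A" using 1 2 A L stable_diff by blast
    ultimately have "l2 - l1 \<in> K \<inter> A" by simp
    then have "l2 - l1 = 0" using A(3) by simp
    then have "l1 = 0" using 1 2 L' by auto
    then show False using 1 K by simp
  qed
  then have "simple_stable A"
    unfolding simple_stable_def using A \<open>A \<noteq> {0}\<close> by blast
  then show ?thesis using that A by blast
qed

text \<open>
  A maximal independent family of simple stable subgroups must span: otherwise a complement of its
  sum contains a simple stable subgroup, which could be added to the family.
\<close>

theorem direct_sum_of_simple: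
  obtains \<N> where "\<And>N. N \<in> \<N> \<Longrightarrow> simple_stable N" "is_direct_sum \<N>"
proof -
  let ?I = "{\<N>. (\<forall>N\<in>\<N>. simple_stable N) \<and> independent_family \<N>}"
  have "\<exists>\<N>\<in>?I. \<forall>X\<in>?I. \<N> \<subseteq> X \<longrightarrow> X = \<N>"
  proof (rule subset_Zorn')
    fix C assume C: "subset.chain ?I C"
    have "independent_family (\<Union>C)"
      unfolding independent_family_def
    proof (intro allI impI)
      fix F f assume F: "finite F \<and> F \<subseteq> \<Union>C \<and> (\<forall>N\<in>F. f N \<in> N) \<and> sum f F = 0"
      show "\<forall>N\<in>F. f N = 0"
      proof (cases "F = {}")
        case False
        then have "C \<noteq> {}" using F by blast
        then obtain \<N> where "\<N> \<in> C" "F \<subseteq> \<N>"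
          using finite_subset_Union_chain[of F C ?I] F C by blast
        moreover from this have "independent_family \<N>"
          using C by (auto simp: subset.chain_def)
        ultimately show ?thesis
          using F independent_familyD[of \<N> F f] by simp
      qed simp
    qed
    then show "\<Union>C \<in> ?I"
      using C by (auto simp: subset.chain_def)
  qed
  then obtain \<N> where "\<N> \<in> ?I" and "\<forall>X\<in>?I. \<N> \<subseteq> X \<longrightarrow> X = \<N>" ..
  then have \<N>: "\<And>N. N \<in> \<N> \<Longrightarrow> simple_stable N" "independent_family \<N>"
    and max: "\<And>X. (\<forall>N\<in>X. simple_stable N) \<Longrightarrow> independent_family X \<Longrightarrow> \<N> \<subseteq> X \<Longrightarrow> X = \<N>"
    by simp_all
  have st: "stable N" if "N \<in> \<N>" for N
    using \<N> that by (auto simp: simple_stable_def)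
  let ?W = "family_sum \<N>"
  have W: "stable ?W" using st by (rule stable_family_sum)
  obtain K where K: "stable K" "?W \<inter> K = {0}" "\<And>x. \<exists>n\<in>?W. \<exists>k\<in>K. x = n + k"
    using complement[OF W] by blast
  have "K = {0}"
  proof (rule ccontr)
    assume "K \<noteq> {0}"
    then obtain A where A: "simple_stable A" "A \<subseteq> K"
      using simple_stable_below K by metis
    then have stA: "stable A" and A0: "A \<noteq> {0}" by (auto simp: simple_stable_def)
    have "A \<notin> \<N>"
    proof
      assume "A \<in> \<N>"
      then have "A \<subseteq> ?W \<inter> K" using family_sum_superset A by blast
      then show False using K A0 stable_zero[OF stA] by blast
    qed
    moreover have "independent_family (insert A \<N>)"
      unfolding independent_family_def
    proof (intro allI impI)
      fix F f assume F: "finite F \<and> F \<subseteq> insert A \<N> \<and> (\<forall>N\<in>F. f N \<in> N) \<and> sum f F = 0"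
      let ?G = "F - {A}"
      have G: "finite ?G" "?G \<subseteq> \<N>" "\<forall>N\<in>?G. f N \<in> N" using F by auto
      have A_part: "f A = 0" if "A \<in> F"
      proof -
        have "f A = - sum f ?G" 
          using F sum.remove[of F A f] that by (simp add: eq_neg_iff_add_eq_0)
        moreover have "sum f ?G \<in> ?W" using G family_sumI[of ?G \<N> f] by simp
        ultimately have "f A \<in> ?W \<inter> K" using W F A that stable_uminus by auto
        then show ?thesis using K by blast
      qed
      then have "sum f ?G = 0" using F by (cases "A \<in> F") (auto simp: sum_diff1)
      then have "\<forall>N\<in>?G. f N = 0" using independent_familyD[OF \<N>(2) G(1,2), of f] G(3) by simp
      then show "\<forall>N\<in>F. f N = 0" using A_part by blast
    qed
    ultimately show False using max[of "insert A \<N>"] \<N> A by auto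
  qed
  then have "?W = UNIV" using K by force
  then have "is_direct_sum \<N>" using is_direct_sum_if_independent st \<N>(2) by blast
  then show ?thesis using that \<N> by blast
qed

end

section \<open>Evaluating and comparing formal sums\<close>

text \<open>
  These rules establish linearity in one argument of a nested Sweedler sum by following its syntax.
  The function in each conclusion, unless it is the identity, has a constant at its head, so that
  backward chaining is deterministic.
\<close>

named_theorems linear_intros

lemma linearI:
  assumes "vector_space s1" "vector_space s2"
    and "\<And>x y. f (x + y) = f x + f y" "\<And>a x. f (s1 a x) = s2 a (f x)"
  shows "Vector_Spaces.linear s1 s2 f"
  using assms by (simp add: Vector_Spaces.linear_iff)

lemma linearD:
  assumes "Vector_Spaces.linear s1 s2 f"
  shows "f (x + y) = f x + f y" "f (s1 a x) = s2 a (f x)" "f 0 = 0" "f (x - y) = f x - f y"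
    and "vector_space s1" "vector_space s2"
proof -
  interpret Vector_Spaces.linear s1 s2 f by fact
  show "f (x + y) = f x + f y" "f (s1 a x) = s2 a (f x)" "f 0 = 0" "f (x - y) = f x - f y"
    by (rule add scale zero diff)+
  show "vector_space s1" "vector_space s2" by unfold_locales
qed

lemma linear_sum_list:
  "Vector_Spaces.linear s1 s2 f \<Longrightarrow> f (\<Sum>x\<leftarrow>xs. g x) = (\<Sum>x\<leftarrow>xs. f (g x))"
  by (induction xs) (simp_all add: linearD)

lemma sum_list_linear [linear_intros]:
  assumes "vector_space s1" "vector_space s2"
    and "\<And>u v. Vector_Spaces.linear s1 s2 (\<lambda>x. F x u v)"
  shows "Vector_Spaces.linear s1 s2 (\<lambda>x. \<Sum>(u, v)\<leftarrow>xs. F x u v)"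
proof (rule linearI)
  interpret V2: vector_space s2 by fact
  show "(\<Sum>(u, v)\<leftarrow>xs. F (x + y) u v) = (\<Sum>(u, v)\<leftarrow>xs. F x u v) + (\<Sum>(u, v)\<leftarrow>xs. F y u v)" for x y
    by (induction xs) (auto simp: linearD(1)[OF assms(3)])
  show "(\<Sum>(u, v)\<leftarrow>xs. F (s1 a x) u v) = s2 a (\<Sum>(u, v)\<leftarrow>xs. F x u v)" for a x
    by (induction xs) (auto simp: linearD(2)[OF assms(3)] V2.scale_right_distrib)
qed (use assms in auto)

lemma sum_list_swap:
  fixes F :: "'a \<Rightarrow> 'b \<Rightarrow> 'z::comm_monoid_add"
  shows "(\<Sum>x\<leftarrow>xs. \<Sum>y\<leftarrow>ys. F x y) = (\<Sum>y\<leftarrow>ys. \<Sum>x\<leftarrow>xs. F x y)"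
  by (induction xs) (simp_all add: sum_list_addf)

lemma sum_list_concat_map:
  "(\<Sum>x\<leftarrow>concat (map g xs). F x) = (\<Sum>x\<leftarrow>xs. \<Sum>y\<leftarrow>g x. F y)"
  by (induction xs) simp_all

text \<open>
  The two universal properties below say that (multi)linear maps are well defined on tensor
  products; a Sweedler calculation applies them to the axioms, which are equations between tensors.
\<close>

lemma formal_sum_eq_eval:
  fixes e :: "'x \<Rightarrow> 'z::ab_group_add"
  assumes "formal_sum_eq R xs ys"
    and "\<And>xs ys. R xs ys \<Longrightarrow> (\<Sum>x\<leftarrow>xs. e x) = (\<Sum>x\<leftarrow>ys. e x)"
  shows "(\<Sum>x\<leftarrow>xs. e x) = (\<Sum>x\<leftarrow>ys. e x)"
  using assms(1) by induction (simp_all add: assms(2) add.commute)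

lemma tensor_eq_eval:
  assumes eq: "tensor_eq s1 s2 xs ys"
    and F: "\<And>w. Vector_Spaces.linear s1 t (\<lambda>v. F v w)" "\<And>v. Vector_Spaces.linear s2 t (F v)"
  shows "(\<Sum>(v, w)\<leftarrow>xs. F v w) = (\<Sum>(v, w)\<leftarrow>ys. F v w)"
  using eq unfolding tensor_eq_def
proof (rule formal_sum_eq_eval)
  fix xs ys assume "bilinear_rel s1 s2 xs ys"
  then show "(\<Sum>(v, w)\<leftarrow>xs. F v w) = (\<Sum>(v, w)\<leftarrow>ys. F v w)"
    by cases (simp_all add: linearD(1-3)[OF F(1)] linearD(1-3)[OF F(2)])
qed

lemma tensor3_eq_eval:
  assumes eq: "tensor3_eq s1 s2 s3 xs ys"
    and G: "\<And>v w. Vector_Spaces.linear s1 t (\<lambda>u. G u v w)"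
      "\<And>u w. Vector_Spaces.linear s2 t (\<lambda>v. G u v w)" "\<And>u v. Vector_Spaces.linear s3 t (G u v)"
  shows "(\<Sum>(u, v, w)\<leftarrow>xs. G u v w) = (\<Sum>(u, v, w)\<leftarrow>ys. G u v w)"
  using eq unfolding tensor3_eq_def
proof (rule formal_sum_eq_eval)
  fix xs ys assume "trilinear_rel s1 s2 s3 xs ys"
  then show "(\<Sum>(u, v, w)\<leftarrow>xs. G u v w) = (\<Sum>(u, v, w)\<leftarrow>ys. G u v w)"
    by cases (simp_all add: linearD(1-3)[OF G(1)] linearD(1-3)[OF G(2)] linearD(1-3)[OF G(3)])
qed

context
  fixes s1 :: "'k::field \<Rightarrow> 'v::ab_group_add \<Rightarrow> 'v" and s2 :: "'k \<Rightarrow> 'w::ab_group_add \<Rightarrow> 'w"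
begin

lemma tensor_eq_refl: "tensor_eq s1 s2 xs xs"
  unfolding tensor_eq_def by (rule formal_sum_eq.refl)

lemma tensor_eq_trans [trans]:
  "tensor_eq s1 s2 xs ys \<Longrightarrow> tensor_eq s1 s2 ys zs \<Longrightarrow> tensor_eq s1 s2 xs zs"
  unfolding tensor_eq_def by (rule formal_sum_eq.trans)

lemma tensor_eq_sym: "tensor_eq s1 s2 xs ys \<Longrightarrow> tensor_eq s1 s2 ys xs"
  unfolding tensor_eq_def by (rule formal_sum_eq.sym)

lemma tensor_eq_append:
  "tensor_eq s1 s2 xs xs' \<Longrightarrow> tensor_eq s1 s2 ys ys' \<Longrightarrow> tensor_eq s1 s2 (xs @ ys) (xs' @ ys')"
  unfolding tensor_eq_def by (rule formal_sum_eq.append)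

lemma tensor_eq_comm: "tensor_eq s1 s2 (xs @ ys) (ys @ xs)"
  unfolding tensor_eq_def by (rule formal_sum_eq.comm)

lemma tensor_eq_base: "bilinear_rel s1 s2 xs ys \<Longrightarrow> tensor_eq s1 s2 xs ys"
  unfolding tensor_eq_def by (rule formal_sum_eq.base)

lemma tensor_eq_Cons:
  "tensor_eq s1 s2 [x] xs \<Longrightarrow> tensor_eq s1 s2 ys ys' \<Longrightarrow> tensor_eq s1 s2 (x # ys) (xs @ ys')"
  using tensor_eq_append[of "[x]" xs ys ys'] by simp

lemma tensor_eq_zero_right:
  assumes "vector_space s1" "vector_space s2"
  shows "tensor_eq s1 s2 [(v, 0)] []"
proof -
  interpret V1: vector_space s1 by fact
  interpret V2: vector_space s2 by fact
  have "tensor_eq s1 s2 [(s1 0 v, 0)] [(v, s2 0 0)]"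
    by (rule tensor_eq_base, rule bilinear_rel.scale)
  then have "tensor_eq s1 s2 [(v, 0)] [(0, 0)]"
    by (simp add: tensor_eq_sym)
  also have "tensor_eq s1 s2 \<dots> []"
    by (rule tensor_eq_base, rule bilinear_rel.zero)
  finally show ?thesis .
qed

lemma tensor_eq_sum_right:
  assumes "vector_space s1" "vector_space s2"
  shows "tensor_eq s1 s2 [(v, \<Sum>b\<leftarrow>bs. s2 (c b) b)] (map (\<lambda>b. (s1 (c b) v, b)) bs)"
proof (induction bs)
  case Nil
  then show ?case using tensor_eq_zero_right[OF assms] by simp
next
  case (Cons b bs)
  have "tensor_eq s1 s2 [(v, \<Sum>b\<leftarrow>b # bs. s2 (c b) b)] ([(v, s2 (c b) b)] @ [(v, \<Sum>b\<leftarrow>bs. s2 (c b) b)])"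
    using tensor_eq_base[OF bilinear_rel.add2] by simp
  also have "tensor_eq s1 s2 \<dots> ([(s1 (c b) v, b)] @ map (\<lambda>b. (s1 (c b) v, b)) bs)"
    by (intro tensor_eq_append Cons tensor_eq_sym[OF tensor_eq_base[OF bilinear_rel.scale]])
  finally show ?case by simp
qed

lemma tensor_eq_merge:
  "tensor_eq s1 s2 (map (\<lambda>b. (f b, b)) bs @ map (\<lambda>b. (g b, b)) bs) (map (\<lambda>b. (f b + g b, b)) bs)"
proof (induction bs)
  case Nil
  then show ?case by (simp add: tensor_eq_refl)
next
  case (Cons b bs)
  let ?f = "map (\<lambda>b. (f b, b))" and ?g = "map (\<lambda>b. (g b, b))"
  have "tensor_eq s1 s2 ([(f b, b)] @ (?f bs @ [(g b, b)]) @ ?g bs) ([(f b, b)] @ ([(g b, b)] @ ?f bs) @ ?g bs)"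
    by (intro tensor_eq_append tensor_eq_refl tensor_eq_comm)
  also have "tensor_eq s1 s2 ([(f b, b)] @ ([(g b, b)] @ ?f bs) @ ?g bs) ([(f b, b), (g b, b)] @ (?f bs @ ?g bs))"
    by (simp add: tensor_eq_refl)
  also have "tensor_eq s1 s2 \<dots> ([(f b + g b, b)] @ map (\<lambda>b. (f b + g b, b)) bs)"
    by (intro tensor_eq_append Cons tensor_eq_sym[OF tensor_eq_base[OF bilinear_rel.add1]])
  finally show ?case by simp
qed

lemma tensor_eq_expand_right:
  assumes s1: "vector_space s1" and s2: "vector_space s2"
    and c: "\<And>v w. (v, w) \<in> set xs \<Longrightarrow> w = (\<Sum>b\<leftarrow>bs. s2 (c w b) b)"
  shows "tensor_eq s1 s2 xs (map (\<lambda>b. (\<Sum>(v, w)\<leftarrow>xs. s1 (c w b) v, b)) bs)"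
  using c
proof (induction xs)
  case Nil
  have "tensor_eq s1 s2 [] (map (\<lambda>b. (0, b)) bs)"
  proof (induction bs)
    case (Cons b bs)
    then show ?case
      using tensor_eq_append[OF tensor_eq_sym[OF tensor_eq_base[OF bilinear_rel.zero[of s1 s2 b]]]]
      by fastforce
  qed (simp add: tensor_eq_refl)
  then show ?case by simp
next
  case (Cons x xs)
  obtain v w where x: "x = (v, w)" by force
  have "tensor_eq s1 s2 [(v, w)] (map (\<lambda>b. (s1 (c w b) v, b)) bs)"
    using tensor_eq_sum_right[OF s1 s2, of v "c w" bs] Cons.prems[of v w] x by simp
  moreover have "tensor_eq s1 s2 xs (map (\<lambda>b. (\<Sum>(v, w)\<leftarrow>xs. s1 (c w b) v, b)) bs)"
  proof (rule Cons.IH)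
    show "w' = (\<Sum>b\<leftarrow>bs. s2 (c w' b) b)" if "(v', w') \<in> set xs" for v' w'
      by (rule Cons.prems[of v']) (simp add: that)
  qed
  ultimately have "tensor_eq s1 s2 (x # xs) (map (\<lambda>b. (s1 (c w b) v, b)) bs @
      map (\<lambda>b. (\<Sum>(v, w)\<leftarrow>xs. s1 (c w b) v, b)) bs)"
    unfolding x by (rule tensor_eq_Cons)
  also have "tensor_eq s1 s2 \<dots> (map (\<lambda>b. (s1 (c w b) v + (\<Sum>(v, w)\<leftarrow>xs. s1 (c w b) v), b)) bs)"
    by (rule tensor_eq_merge)
  finally show ?case by (simp add: x)
qed

text \<open>
  Applying functionals on the right factor detects whether a tensor lies in \<open>N \<otimes> W\<close>: after expanding
  along basis vectors of \<open>W\<close>, the left factors are the slices at the coordinate functionals.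
  This is what turns statements about coactions into statements about operators.
\<close>

lemma tensor_eq_supported:
  assumes s1: "vector_space s1" and s2: "vector_space s2"
    and slices: "\<And>f. Vector_Spaces.linear s2 (*) f \<Longrightarrow> (\<Sum>(v, w)\<leftarrow>xs. s1 (f w) v) \<in> N"
  obtains ys where "set ys \<subseteq> N \<times> UNIV" "tensor_eq s1 s2 xs ys"
proof -
  interpret V2: vector_space s2 by fact
  define B where "B = V2.extend_basis {}"
  have B: "V2.independent B" "V2.span B = UNIV"
    unfolding B_def using V2.independent_extend_basis V2.span_extend_basis V2.independent_empty by auto
  let ?r = "V2.representation B"
  define T where "T = (\<Union>(v, w)\<in>set xs. {b. ?r w b \<noteq> 0})"
  have "finite T" unfolding T_def using V2.finite_representation by auto
  then obtain bs where bs: "set bs = T" "distinct bs"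
    using finite_distinct_list by blast
  have expand: "w = (\<Sum>b\<leftarrow>bs. s2 (?r w b) b)" if "(v, w) \<in> set xs" for v w
  proof -
    have "w = (\<Sum>b | ?r w b \<noteq> 0. s2 (?r w b) b)"
      using B V2.sum_nonzero_representation_eq[of B w] by simp
    also have "\<dots> = (\<Sum>b\<in>T. s2 (?r w b) b)"
      by (rule sum.mono_neutral_left[OF \<open>finite T\<close>]) (use that in \<open>auto simp: T_def\<close>)
    finally show ?thesis using bs by (simp add: sum_list_distinct_conv_sum_set)
  qed
  have "tensor_eq s1 s2 xs (map (\<lambda>b. (\<Sum>(v, w)\<leftarrow>xs. s1 (?r w b) v, b)) bs)"
    by (rule tensor_eq_expand_right[OF s1 s2 expand])
  moreover have "(\<Sum>(v, w)\<leftarrow>xs. s1 (?r w b) v) \<in> N" for b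
    by (rule slices) (rule V2.linear_representation[OF B])
  ultimately show ?thesis
    using that[of "map (\<lambda>b. (\<Sum>(v, w)\<leftarrow>xs. s1 (?r w b) v, b)) bs"] by auto
qed

end

lemma tensor_eq_map_scale:
  assumes "vector_space s1" "tensor_eq s1 s2 xs ys"
  shows "tensor_eq s1 s2 (map (\<lambda>(v, w). (s1 c v, w)) xs) (map (\<lambda>(v, w). (s1 c v, w)) ys)"
  using assms(2) unfolding tensor_eq_def
proof induction
  case (base xs ys)
  interpret vector_space s1 by fact
  from base show ?case
  proof cases
    case (scale a v w)
    have "formal_sum_eq (bilinear_rel s1 s2) [(s1 a (s1 c v), w)] [(s1 c v, s2 a w)]"
      by (intro formal_sum_eq.base bilinear_rel.scale)
    then show ?thesis using scale by (simp add: mult.commute)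
  qed (auto simp: scale_right_distrib intro: formal_sum_eq.base bilinear_rel.intros)
qed (auto intro: formal_sum_eq.intros)

section \<open>Sweedler calculus\<close>

lemma linear_compose_fun:
  "Vector_Spaces.linear s2 s3 f \<Longrightarrow> Vector_Spaces.linear s1 s2 g \<Longrightarrow> Vector_Spaces.linear s1 s3 (\<lambda>x. f (g x))"
  by (auto simp: Vector_Spaces.linear_iff)

lemma vector_space_mult: "vector_space ((*) :: 'k::field \<Rightarrow> 'k \<Rightarrow> 'k)"
  by unfold_locales (simp_all add: algebra_simps)

context vector_space
begin

lemma linear_ident: "Vector_Spaces.linear scale scale (\<lambda>x. x)"
  by (rule linearI) (auto intro: vector_space_axioms)

lemma linear_scale_left:
  "Vector_Spaces.linear s1 (*) g \<Longrightarrow> Vector_Spaces.linear s1 scale (\<lambda>x. scale (g x) c)"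
  by (rule linearI) (auto simp: linearD scale_left_distrib intro: vector_space_axioms)

lemma linear_scale_right:
  "Vector_Spaces.linear s1 scale g \<Longrightarrow> Vector_Spaces.linear s1 scale (\<lambda>x. scale c (g x))"
  by (rule linearI) (auto simp: linearD scale_right_distrib mult.commute intro: vector_space_axioms)

lemma exists_linear_projection:
  assumes "subspace N"
  obtains q where "Vector_Spaces.linear scale scale q" "range q \<subseteq> N" "\<And>n. n \<in> N \<Longrightarrow> q n = n"
proof -
  interpret vector_space_pair scale scale by unfold_locales
  show ?thesis
    using linear_exists_left_inverse_on[OF linear_ident assms inj_on_id2] that by blast
qed

lemma exists_functional:
  assumes "x \<noteq> 0"
  obtains f where "Vector_Spaces.linear scale (*) f" "f x = 1"
proof -
  interpret K: vector_space "(*) :: 'a \<Rightarrow> 'a \<Rightarrow> 'a" by (rule vector_space_mult)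
  interpret vector_space_pair scale "(*) :: 'a \<Rightarrow> 'a \<Rightarrow> 'a" by unfold_locales
  show ?thesis
    using linear_independent_extend[of "{x}" "\<lambda>_. 1"] assms that by (auto simp: dependent_single)
qed

end

context coalgebra
begin

text \<open>
  The sum \<open>F h\<^sub>1 h\<^sub>2\<close> in Sweedler notation. Iterated coproducts are nested sums, in which the variables
  bound at one level may be split again at the next.
\<close>

definition sweedler :: "'c \<Rightarrow> ('c \<Rightarrow> 'c \<Rightarrow> 'z) \<Rightarrow> 'z::ab_group_add" where
  "sweedler x F = (\<Sum>(u, v)\<leftarrow>\<Delta> x. F u v)"

lemmas [linear_intros] = vector_space_axioms vector_space_mult linear_ident

lemma sweedler_linear [linear_intros]:
  assumes g: "Vector_Spaces.linear s scale g"
    and F: "\<And>v. Vector_Spaces.linear scale t (\<lambda>u. F u v)" "\<And>u. Vector_Spaces.linear scale t (F u)"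
  shows "Vector_Spaces.linear s t (\<lambda>x. sweedler (g x) F)"
proof (rule linear_compose_fun[OF _ g, of t "\<lambda>x. sweedler x F"], rule linearI)
  show "vector_space t" using F(1) by (rule linearD)
  show "sweedler (x + y) F = sweedler x F + sweedler y F" for x y
    unfolding sweedler_def using tensor_eq_eval[OF comult_add F] by simp
  show "sweedler (scale a x) F = t a (sweedler x F)" for a x
    unfolding sweedler_def using tensor_eq_eval[OF comult_scale F, of a x]
    by (simp add: linear_sum_list[OF vector_space.linear_scale_right[OF \<open>vector_space t\<close> vector_space.linear_ident[OF \<open>vector_space t\<close>]]]
        linearD(2)[OF F(1)] case_prod_unfold o_def)
qed (rule vector_space_axioms)

lemma sweedler_linear_body [linear_intros]:
  assumes "vector_space s" "vector_space t" "\<And>u v. Vector_Spaces.linear s t (\<lambda>x. F x u v)"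
  shows "Vector_Spaces.linear s t (\<lambda>x. sweedler c (F x))"
  unfolding sweedler_def by (intro sum_list_linear assms)

lemma sweedler_cong: "(\<And>u v. F u v = G u v) \<Longrightarrow> sweedler x F = sweedler x G"
  by (simp add: sweedler_def)

lemma linear_sweedler:
  "Vector_Spaces.linear s t g \<Longrightarrow> g (sweedler x F) = sweedler x (\<lambda>u v. g (F u v))"
  unfolding sweedler_def by (subst linear_sum_list) (auto simp: case_prod_unfold)

lemma sweedler_swap_list:
  "sweedler x (\<lambda>u v. \<Sum>(a, b)\<leftarrow>ys. F u v a b) = (\<Sum>(a, b)\<leftarrow>ys. sweedler x (\<lambda>u v. F u v a b))"
  unfolding sweedler_def by (simp add: case_prod_unfold sum_list_swap[of _ "\<Delta> x"])

lemma sweedler_swap: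
  "sweedler x (\<lambda>u v. sweedler y (\<lambda>a b. F u v a b)) = sweedler y (\<lambda>a b. sweedler x (\<lambda>u v. F u v a b))"
  unfolding sweedler_def[of y] by (rule sweedler_swap_list)

lemma sweedler_coassoc:
  assumes "\<And>v w. Vector_Spaces.linear scale t (\<lambda>u. G u v w)"
    "\<And>u w. Vector_Spaces.linear scale t (\<lambda>v. G u v w)" "\<And>u v. Vector_Spaces.linear scale t (G u v)"
  shows "sweedler x (\<lambda>u v. sweedler u (\<lambda>p q. G p q v)) = sweedler x (\<lambda>u v. sweedler v (\<lambda>p q. G u p q))"
  using tensor3_eq_eval[OF coassoc assms, of x]
  by (simp add: sweedler_def sum_list_concat_map case_prod_unfold o_def)

lemma sweedler_counit_left:
  assumes "Vector_Spaces.linear scale t g"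
  shows "sweedler x (\<lambda>u v. t (\<epsilon> u) (g v)) = g x"
  using linear_sweedler[OF assms, of x "\<lambda>u v. scale (\<epsilon> u) v"] counit_left[of x]
  by (simp add: sweedler_def linearD(2)[OF assms])

lemma sweedler_counit_right:
  assumes "Vector_Spaces.linear scale t g"
  shows "sweedler x (\<lambda>u v. t (\<epsilon> v) (g u)) = g x"
  using linear_sweedler[OF assms, of x "\<lambda>u v. scale (\<epsilon> v) u"] counit_right[of x]
  by (simp add: sweedler_def linearD(2)[OF assms])

end

context hopf_algebra
begin

lemma mult_linear [linear_intros]:
  "Vector_Spaces.linear s scale g \<Longrightarrow> Vector_Spaces.linear s scale (\<lambda>x. g x * c)"
  "Vector_Spaces.linear s scale g \<Longrightarrow> Vector_Spaces.linear s scale (\<lambda>x. c * g x)"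
  by (auto simp: Vector_Spaces.linear_iff algebra_simps scale_mult_left scale_mult_right)

lemmas antipode_linear_intro [linear_intros] = linear_compose_fun[OF antipode_linear]
  and counit_linear_intro [linear_intros] = linear_compose_fun[OF counit_linear]
  and scale_linear_intros [linear_intros] = linear_scale_left linear_scale_right

lemma sweedler_mult:
  assumes "\<And>v. Vector_Spaces.linear scale t (\<lambda>u. F u v)" "\<And>u. Vector_Spaces.linear scale t (F u)"
  shows "sweedler (x * y) F = sweedler x (\<lambda>u v. sweedler y (\<lambda>a b. F (u * a) (v * b)))"
  using tensor_eq_eval[OF comult_mult assms, of x y]
  by (simp add: sweedler_def sum_list_concat_map case_prod_unfold o_def)

lemma sweedler_one:
  assumes "\<And>v. Vector_Spaces.linear scale t (\<lambda>u. F u v)" "\<And>u. Vector_Spaces.linear scale t (F u)"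
  shows "sweedler 1 F = F 1 1"
  using tensor_eq_eval[OF comult_one assms] by (simp add: sweedler_def)

lemma sweedler_antipode_left:
  assumes "Vector_Spaces.linear scale t g"
  shows "sweedler x (\<lambda>u v. g (S u * v)) = t (\<epsilon> x) (g 1)"
  using linear_sweedler[OF assms, of x "\<lambda>u v. S u * v"] antipode_left[of x]
  by (simp add: sweedler_def linearD(2)[OF assms])

lemma sweedler_antipode_right:
  assumes "Vector_Spaces.linear scale t g"
  shows "sweedler x (\<lambda>u v. g (u * S v)) = t (\<epsilon> x) (g 1)"
  using linear_sweedler[OF assms, of x "\<lambda>u v. u * S v"] antipode_right[of x]
  by (simp add: sweedler_def linearD(2)[OF assms])

context
  fixes t :: "'k \<Rightarrow> 'z::ab_group_add \<Rightarrow> 'z" and G :: "'h \<Rightarrow> 'h \<Rightarrow> 'z"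
  assumes G1: "\<And>v. Vector_Spaces.linear scale t (\<lambda>u. G u v)"
    and G2: "\<And>u. Vector_Spaces.linear scale t (G u)"
begin

lemmas G_intros = linear_compose_fun[OF G1] linear_compose_fun[OF G2]

text \<open>
  In an iterated coproduct two neighbouring factors, one of them under the antipode, multiply to a
  scalar and disappear. Each of the following lemmas gives this for both nestings of a threefold
  coproduct; \<open>G\<close> is the rest of the expression, and the vanished product leaves \<open>1\<close> in its place.
\<close>

lemma cancel_antipode_right:
  "sweedler x (\<lambda>u v. sweedler v (\<lambda>p q. G u (p * S q))) = G x 1"
  "sweedler x (\<lambda>u v. sweedler u (\<lambda>p q. G p (q * S v))) = G x 1"
proof -
  show 1: "sweedler x (\<lambda>u v. sweedler v (\<lambda>p q. G u (p * S q))) = G x 1"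
    by (simp add: sweedler_antipode_right[OF G2] sweedler_counit_right[OF G1])
  show "sweedler x (\<lambda>u v. sweedler u (\<lambda>p q. G p (q * S v))) = G x 1"
    unfolding 1[symmetric] by (rule sweedler_coassoc[where t = t]) (intro G_intros linear_intros)+
qed

lemma cancel_antipode_left_of_right:
  "sweedler x (\<lambda>u v. sweedler v (\<lambda>p q. G u (S p * q))) = G x 1"
  "sweedler x (\<lambda>u v. sweedler u (\<lambda>p q. G p (S q * v))) = G x 1"
proof -
  show 1: "sweedler x (\<lambda>u v. sweedler v (\<lambda>p q. G u (S p * q))) = G x 1"
    by (simp add: sweedler_antipode_left[OF G2] sweedler_counit_right[OF G1])
  show "sweedler x (\<lambda>u v. sweedler u (\<lambda>p q. G p (S q * v))) = G x 1"
    unfolding 1[symmetric] by (rule sweedler_coassoc[where t = t]) (intro G_intros linear_intros)+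
qed

lemma cancel_antipode_left:
  "sweedler x (\<lambda>u v. sweedler u (\<lambda>p q. G (S p * q) v)) = G 1 x"
  "sweedler x (\<lambda>u v. sweedler v (\<lambda>p q. G (S u * p) q)) = G 1 x"
proof -
  show 1: "sweedler x (\<lambda>u v. sweedler u (\<lambda>p q. G (S p * q) v)) = G 1 x"
    by (simp add: sweedler_antipode_left[OF G1] sweedler_counit_left[OF G2])
  show "sweedler x (\<lambda>u v. sweedler v (\<lambda>p q. G (S u * p) q)) = G 1 x"
    unfolding 1[symmetric] by (rule sweedler_coassoc[where t = t, symmetric]) (intro G_intros linear_intros)+
qed

end

end

section \<open>Components of a direct sum\<close>

lemma direct_sum_decomposition:
  assumes "is_direct_sum \<N>"
  obtains f where "\<And>N. N \<in> \<N> \<Longrightarrow> f N \<in> N" "\<And>N. f N \<noteq> 0 \<Longrightarrow> N \<in> \<N>"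
    "finite {N. f N \<noteq> 0}" "x = (\<Sum>N | f N \<noteq> 0. f N)"
  using assms[unfolded is_direct_sum_def, THEN spec, of x] by metis

lemma direct_sum_induct [consumes 1]:
  assumes "is_direct_sum \<N>" "P 0" "\<And>x y. P x \<Longrightarrow> P y \<Longrightarrow> P (x + y)"
    and "\<And>N x. N \<in> \<N> \<Longrightarrow> x \<in> N \<Longrightarrow> P x"
  shows "P x"
proof -
  obtain f where f: "\<And>N. N \<in> \<N> \<Longrightarrow> f N \<in> N" "\<And>N. f N \<noteq> 0 \<Longrightarrow> N \<in> \<N>"
    "finite {N. f N \<noteq> 0}" "x = (\<Sum>N | f N \<noteq> 0. f N)"
    using direct_sum_decomposition[OF assms(1)] by metis
  have "P (\<Sum>N\<in>F. f N)" if "finite F" "F \<subseteq> {N. f N \<noteq> 0}" for F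
    using that
  proof (induction F)
    case (insert N F)
    then have "N \<in> \<N>" using f(2) by simp
    then have "P (f N + sum f F)"
      using insert by (intro assms(3) assms(4)[OF _ f(1)]) simp_all
    then show ?case using insert by simp
  qed (simp add: assms(2))
  then show ?thesis using f(3,4) by simp
qed

text \<open>
  Uniqueness of the decomposition makes taking the component in a fixed summand linear; \<open>\<pi>\<close> is the
  component in some summand where \<open>x\<close> does not vanish.
\<close>

lemma (in vector_space) direct_sum_nonzero_component:
  assumes sum: "is_direct_sum \<N>" and sub: "\<And>N. N \<in> \<N> \<Longrightarrow> subspace N" and x: "x \<noteq> 0"
  obtains D \<pi> where "D \<in> \<N>" "Vector_Spaces.linear scale scale \<pi>" "\<pi> x \<noteq> 0"
    "\<And>N y. N \<in> \<N> \<Longrightarrow> N \<noteq> D \<Longrightarrow> y \<in> N \<Longrightarrow> \<pi> y = 0"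
proof -
  \<comment> \<open>\<open>Q v f\<close>: the family \<open>f\<close> is the decomposition of \<open>v\<close>.\<close>
  define Q where "Q v f \<longleftrightarrow> (\<forall>N\<in>\<N>. f N \<in> N) \<and> (\<forall>N. N \<notin> \<N> \<longrightarrow> f N = 0) \<and>
        finite {N. f N \<noteq> 0} \<and> v = (\<Sum>N | f N \<noteq> 0. f N)" for v f
  have ex1: "\<exists>!f. Q v f" for v
    using sum[unfolded is_direct_sum_def, THEN spec, of v] unfolding Q_def .
  define d where "d v = (THE f. Q v f)" for v
  have Qd: "Q v (d v)" for v
    unfolding d_def by (rule theI'[OF ex1])
  have d_eqI: "d v = f" if "Q v f" for v f
    unfolding d_def by (rule the1_equality, rule ex1, rule that)
  have mem: "d v N \<in> N" if "N \<in> \<N>" for v N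
    using Qd[of v] that by (simp add: Q_def)
  have out: "d v N = 0" if "N \<notin> \<N>" for v N
    using Qd[of v] that by (simp add: Q_def)
  have fin: "finite {N. d v N \<noteq> 0}" for v
    using Qd[of v] by (simp add: Q_def)
  have sum_d: "(\<Sum>N\<in>U. d v N) = v" if "finite U" "{N. d v N \<noteq> 0} \<subseteq> U" for v U
  proof -
    have "v = (\<Sum>N | d v N \<noteq> 0. d v N)" using Qd[of v] by (simp add: Q_def)
    also have "\<dots> = (\<Sum>N\<in>U. d v N)" by (rule sum.mono_neutral_left[OF that]) simp
    finally show ?thesis by simp
  qed
  have d_add: "d (v + w) = (\<lambda>N. d v N + d w N)" for v w
  proof (rule d_eqI)
    let ?U = "{N. d v N \<noteq> 0} \<union> {N. d w N \<noteq> 0}"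
    have "(\<Sum>N | d v N + d w N \<noteq> 0. d v N + d w N) = (\<Sum>N\<in>?U. d v N + d w N)"
      by (rule sum.mono_neutral_left) (auto simp: fin)
    also have "\<dots> = v + w"
      unfolding sum.distrib by (subst (1 2) sum_d) (auto simp: fin)
    finally have "v + w = (\<Sum>N | d v N + d w N \<noteq> 0. d v N + d w N)" ..
    moreover have "finite {N. d v N + d w N \<noteq> 0}"
      by (rule finite_subset[of _ ?U]) (auto simp: fin)
    moreover have "d v N + d w N \<in> N" if "N \<in> \<N>" for N
      by (rule subspace_add[OF sub[OF that] mem[OF that] mem[OF that]])
    ultimately show "Q (v + w) (\<lambda>N. d v N + d w N)"
      using out unfolding Q_def by simp
  qed
  have d_scale: "d (scale a v) = (\<lambda>N. scale a (d v N))" for a v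
  proof (rule d_eqI)
    have "(\<Sum>N | scale a (d v N) \<noteq> 0. scale a (d v N)) = (\<Sum>N | d v N \<noteq> 0. scale a (d v N))"
      by (rule sum.mono_neutral_left) (auto simp: fin)
    also have "\<dots> = scale a v"
      unfolding scale_sum_right[symmetric] by (subst sum_d) (auto simp: fin)
    finally have "scale a v = (\<Sum>N | scale a (d v N) \<noteq> 0. scale a (d v N))" ..
    moreover have "finite {N. scale a (d v N) \<noteq> 0}"
      by (rule finite_subset[OF _ fin[of v]]) auto
    moreover have "scale a (d v N) \<in> N" if "N \<in> \<N>" for N
      by (rule subspace_scale[OF sub[OF that] mem[OF that]])
    ultimately show "Q (scale a v) (\<lambda>N. scale a (d v N))"
      using out unfolding Q_def by simp
  qed
  have d_single: "d y = (\<lambda>M. if M = N then y else 0)" if "N \<in> \<N>" "y \<in> N" for N y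
  proof (rule d_eqI)
    have "{M. (if M = N then y else 0) \<noteq> 0} = (if y = 0 then {} else {N})" by auto
    then show "Q y (\<lambda>M. if M = N then y else 0)"
      using that sub subspace_0 unfolding Q_def by (auto split: if_splits)
  qed
  have "\<exists>D. d x D \<noteq> 0"
    using sum_d[of "{}" x] x by force
  then obtain D where D: "d x D \<noteq> 0" by blast
  have "Vector_Spaces.linear scale scale (\<lambda>v. d v D)"
    by (rule linearI) (simp_all add: vector_space_axioms d_add d_scale)
  moreover have "d y D = 0" if "N \<in> \<N>" "N \<noteq> D" "y \<in> N" for N y
    using d_single[OF that(1,3)] that(2) by simp
  moreover have "D \<in> \<N>" using D out by blast
  ultimately show ?thesis using that[of D "\<lambda>v. d v D"] D by blast
qed

section \<open>The invariant functional of a cosemisimple Hopf algebra\<close>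

context hopf_algebra
begin

lemma comult_scaled_one: "tensor_eq scale scale (\<Delta> (scale c 1)) [(scale c 1, 1)]"
proof -
  have "tensor_eq scale scale (\<Delta> (scale c 1)) (map (\<lambda>(u, v). (scale c u, v)) (\<Delta> 1))"
    using comult_scale[of c 1] by (simp add: case_prod_unfold)
  also have "tensor_eq scale scale \<dots> (map (\<lambda>(u, v). (scale c u, v)) [(1, 1)])"
    by (rule tensor_eq_map_scale[OF vector_space_axioms comult_one])
  finally show ?thesis by simp
qed

text \<open>
  The functional \<open>\<phi>\<close> reads off the coefficient of \<open>1\<close> and kills all other simple subcoalgebras, which
  makes it invariant because each summand has its coproduct in its own tensor square. What has to
  be seen is that the line through \<open>1\<close> is one of the given summands. Pick a summand \<open>D\<close> where \<open>1\<close> has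
  a nonzero component and a functional \<open>\<phi>\<close> that factors through the component in \<open>D\<close> with \<open>\<phi> 1 = 1\<close>.
  The operator \<open>h \<mapsto> \<phi>(h\<^sub>2) h\<^sub>1\<close> maps into \<open>D\<close> and fixes \<open>1\<close>, since \<open>\<Delta> 1 = 1 \<otimes> 1\<close>. So \<open>D\<close> contains
  the subcoalgebra spanned by \<open>1\<close>, and equals it by simplicity.
\<close>

lemma normalized_cointegral:
  assumes "cosemisimple"
  obtains \<phi> where "Vector_Spaces.linear scale (*) \<phi>" "\<phi> 1 = 1"
    "\<And>x. sweedler x (\<lambda>u v. scale (\<phi> v) u) = scale (\<phi> x) 1"
proof -
  obtain \<D> where simple: "\<And>D. D \<in> \<D> \<Longrightarrow> simple_subcoalgebra D" and sum: "is_direct_sum \<D>"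
    using assms unfolding cosemisimple_def by blast
  have subcoalg: "subspace D" "\<And>x. x \<in> D \<Longrightarrow> \<exists>ys. set ys \<subseteq> D \<times> D \<and> tensor_eq scale scale (\<Delta> x) ys"
    if "D \<in> \<D>" for D
    using simple[OF that] by (auto simp: simple_subcoalgebra_def subcoalgebra_def)
  obtain D \<pi> where D: "D \<in> \<D>" and \<pi>: "Vector_Spaces.linear scale scale \<pi>" "\<pi> 1 \<noteq> 0"
    "\<And>N x. N \<in> \<D> \<Longrightarrow> N \<noteq> D \<Longrightarrow> x \<in> N \<Longrightarrow> \<pi> x = 0"
    using direct_sum_nonzero_component[OF sum subcoalg(1), of 1] by auto
  obtain g where g: "Vector_Spaces.linear scale (*) g" "g (\<pi> 1) = 1"
    using exists_functional[OF \<pi>(2)] by blast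
  define \<phi> where "\<phi> x = g (\<pi> x)" for x
  have \<phi>_lin: "Vector_Spaces.linear scale (*) \<phi>"
    unfolding \<phi>_def by (rule linear_compose_fun[OF g(1) \<pi>(1)])
  note intros = linear_compose_fun[OF \<phi>_lin] linear_intros
  have \<phi>_one: "\<phi> 1 = 1" by (simp add: \<phi>_def g)
  have \<phi>_zero: "\<phi> x = 0" if "N \<in> \<D>" "N \<noteq> D" "x \<in> N" for N x
    using \<pi>(3)[OF that] linearD(3)[OF g(1)] by (simp add: \<phi>_def)
  let ?l = "\<lambda>x. sweedler x (\<lambda>u v. scale (\<phi> v) u)"
  have l_lin: "Vector_Spaces.linear scale scale ?l"
    by (intro intros)+
  have l_eval: "?l x = (\<Sum>(u, v)\<leftarrow>ys. scale (\<phi> v) u)" if "tensor_eq scale scale (\<Delta> x) ys" for x ys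
    unfolding sweedler_def by (rule tensor_eq_eval[OF that, where t = scale]) (intro intros)+
  have l_zero: "?l x = 0" if N: "N \<in> \<D>" "N \<noteq> D" "x \<in> N" for N x
  proof -
    obtain ys where ys: "set ys \<subseteq> N \<times> N" "tensor_eq scale scale (\<Delta> x) ys"
      using subcoalg(2) N by blast
    have "(\<Sum>(u, v)\<leftarrow>ys. scale (\<phi> v) u) = 0"
      using ys(1) by (induction ys) (auto simp: \<phi>_zero[OF N(1,2)])
    then show ?thesis using l_eval[OF ys(2)] by simp
  qed
  have l_D: "?l x \<in> D" if x: "x \<in> D" for x
  proof -
    obtain ys where ys: "set ys \<subseteq> D \<times> D" "tensor_eq scale scale (\<Delta> x) ys"
      using subcoalg(2) D x by blast
    have "(\<Sum>(u, v)\<leftarrow>ys. scale (\<phi> v) u) \<in> D"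
      using ys(1) subcoalg(1)[OF D]
      by (induction ys) (auto intro: subspace_0 subspace_add subspace_scale)
    then show ?thesis using l_eval[OF ys(2)] by simp
  qed
  have "?l x \<in> D" for x
    using sum
  proof (rule direct_sum_induct[where P = "\<lambda>x. ?l x \<in> D"])
    show "?l 0 \<in> D" using linearD(3)[OF l_lin] subcoalg(1)[OF D] by (simp add: subspace_0)
    show "?l (x + y) \<in> D" if "?l x \<in> D" "?l y \<in> D" for x y
      using linearD(1)[OF l_lin] subcoalg(1)[OF D] that by (simp add: subspace_add)
    show "?l x \<in> D" if "N \<in> \<D>" "x \<in> N" for N x
      using l_zero l_D that subspace_0[OF subcoalg(1)[OF D]] by (cases "N = D") auto
  qed
  moreover have l_one: "?l 1 = 1"
    by (subst sweedler_one[where t = scale]) (intro intros | simp add: \<phi>_one)+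
  ultimately have "1 \<in> D" by metis
  let ?E = "range (\<lambda>c. scale c 1)"
  have "?E \<subseteq> D"
    using \<open>1 \<in> D\<close> subcoalg(1)[OF D] by (auto intro: subspace_scale)
  moreover have one_E: "(1::'h) \<in> ?E"
    by (rule range_eqI[of _ _ 1]) simp
  moreover have "subcoalgebra ?E"
    unfolding subcoalgebra_def
  proof (intro conjI ballI)
    have "subspace (span {1})" by (rule subspace_span)
    then show "subspace ?E" by (simp add: span_singleton)
    fix x assume "x \<in> ?E"
    then obtain c where "x = scale c 1" by blast
    moreover note one_E
    ultimately show "\<exists>ys. set ys \<subseteq> ?E \<times> ?E \<and> tensor_eq scale scale (\<Delta> x) ys"
      using comult_scaled_one[of c] by (intro exI[of _ "[(scale c 1, 1)]"]) auto
  qed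
  moreover have "?E \<noteq> {0}"
    using one_E by (metis singletonD zero_neq_one)
  ultimately have D_eq: "D = ?E"
    using simple[OF D] unfolding simple_subcoalgebra_def by metis
  have "?l x = scale (\<phi> x) 1" for x
    using sum
  proof (rule direct_sum_induct[where P = "\<lambda>x. ?l x = scale (\<phi> x) 1"])
    show "?l 0 = scale (\<phi> 0) 1" using linearD(3)[OF l_lin] linearD(3)[OF \<phi>_lin] by simp
    show "?l (x + y) = scale (\<phi> (x + y)) 1" if "?l x = scale (\<phi> x) 1" "?l y = scale (\<phi> y) 1" for x y
      using that linearD(1)[OF l_lin] linearD(1)[OF \<phi>_lin] by (simp add: scale_left_distrib)
    show "?l x = scale (\<phi> x) 1" if N: "N \<in> \<D>" "x \<in> N" for N x
    proof (cases "N = D")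
      case True
      then obtain c where "x = scale c 1" using D_eq N by auto
      then show ?thesis
        using linearD(2)[OF l_lin] linearD(2)[OF \<phi>_lin] by (simp add: l_one \<phi>_one)
    next
      case False
      then show ?thesis using l_zero \<phi>_zero N by simp
    qed
  qed
  then show ?thesis using that \<phi>_lin \<phi>_one by blast
qed

end

section \<open>The antipode and the integral of a commutative Hopf algebra\<close>

locale commutative_hopf_algebra = hopf_algebra scale \<Delta> \<epsilon> S
  for scale :: "'k::field \<Rightarrow> 'h::comm_ring_1 \<Rightarrow> 'h"
    and \<Delta> :: "'h \<Rightarrow> ('h \<times> 'h) list"
    and \<epsilon> :: "'h \<Rightarrow> 'k"
    and S :: "'h \<Rightarrow> 'h"
begin

text \<open>
  Both sides are convolution inverse to the multiplication \<open>H \<otimes> H \<rightarrow> H\<close>. In Sweedler notation,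
  \<open>S(x y) = S(x\<^sub>1 y\<^sub>1) x\<^sub>2 y\<^sub>2 S(x\<^sub>3) S(y\<^sub>3) = S(x) S(y)\<close>.
\<close>

lemma antipode_mult: "S (x * y) = S x * S y"
proof -
  have "S (x * y) = sweedler x (\<lambda>u v. sweedler u (\<lambda>a b. S (a * y) * (b * S v)))"
    by (subst cancel_antipode_right(2)[where t = scale]) (intro linear_intros | simp)+
  also have "\<dots> = sweedler x (\<lambda>u v. sweedler u (\<lambda>a b.
      sweedler y (\<lambda>u' v'. sweedler u' (\<lambda>a' b'. S (a * a') * (b' * S v') * (b * S v)))))"
    by (subst cancel_antipode_right(2)[where t = scale]) (intro linear_intros | simp)+
  also have "\<dots> = sweedler x (\<lambda>u v. sweedler y (\<lambda>u' v'.
      sweedler u (\<lambda>a b. sweedler u' (\<lambda>a' b'. (S (a * a') * (b * b')) * (S v * S v')))))"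
    by (subst sweedler_swap) (simp add: mult_ac)
  also have "\<dots> = sweedler x (\<lambda>u v. sweedler y (\<lambda>u' v'.
      sweedler (u * u') (\<lambda>p q. (S p * q) * (S v * S v'))))"
    by (subst sweedler_mult[where t = scale]) (intro linear_intros | simp)+
  also have "\<dots> = sweedler x (\<lambda>u v. sweedler y (\<lambda>u' v'. scale (\<epsilon> u') (scale (\<epsilon> u) (S v * S v'))))"
  proof -
    have "Vector_Spaces.linear scale scale (\<lambda>w. w * (S v * S v'))" for v v'
      by (intro linear_intros)
    from sweedler_antipode_left[OF this] show ?thesis
      by (simp add: counit_mult mult.commute)
  qed
  also have "\<dots> = sweedler x (\<lambda>u v. scale (\<epsilon> u) (S v * S y))"
    by (subst sweedler_counit_left) (intro linear_intros | simp)+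
  also have "\<dots> = S x * S y"
    by (subst sweedler_counit_left) (intro linear_intros | simp)+
  finally show ?thesis .
qed

text \<open>
  Both sides are convolution inverse to \<open>\<Delta>\<close>: in the algebra \<open>H \<otimes> H\<close>,
  \<open>\<Delta>(S x) = \<Delta>(S x\<^sub>1) (x\<^sub>2 S(x\<^sub>5) \<otimes> x\<^sub>3 S(x\<^sub>4)) = \<Delta>(S(x\<^sub>1) x\<^sub>2) (S(x\<^sub>4) \<otimes> S(x\<^sub>3)) = S(x\<^sub>2) \<otimes> S(x\<^sub>1)\<close>.
\<close>

lemma antipode_comult:
  assumes F: "\<And>v. Vector_Spaces.linear scale t (\<lambda>u. F u v)"
    "\<And>u. Vector_Spaces.linear scale t (F u)"
  shows "sweedler (S x) F = sweedler x (\<lambda>u v. F (S v) (S u))"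
proof -
  note intros = linear_compose_fun[OF F(1)] linear_compose_fun[OF F(2)] linear_intros linearD(6)[OF F(1)]
  have "sweedler (S x) F = sweedler x (\<lambda>c z. sweedler z (\<lambda>p q. sweedler (S c) (\<lambda>a b. F (a * (p * S q)) b)))"
    by (subst cancel_antipode_right(1)[where t = t]) (intro intros | simp)+
  also have "\<dots> = sweedler x (\<lambda>c z. sweedler z (\<lambda>p q. sweedler p (\<lambda>u v. sweedler u (\<lambda>d e.
      sweedler (S c) (\<lambda>a b. F (a * (d * S q)) (b * (e * S v)))))))"
    by (subst cancel_antipode_right(2)[where t = t]) (intro intros | simp)+
  also have "\<dots> = sweedler x (\<lambda>c z. sweedler z (\<lambda>u w. sweedler w (\<lambda>v q. sweedler u (\<lambda>d e.
      sweedler (S c) (\<lambda>a b. F (a * (d * S q)) (b * (e * S v)))))))"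
    by (subst sweedler_coassoc[where t = t]) (intro intros | simp)+
  also have "\<dots> = sweedler x (\<lambda>c z. sweedler z (\<lambda>u w. sweedler w (\<lambda>v q.
      sweedler (S c * u) (\<lambda>a b. F (a * S q) (b * S v)))))"
    by (subst sweedler_mult[where t = t], (intro intros)+) (subst sweedler_swap, simp add: mult_ac)
  also have "\<dots> = sweedler x (\<lambda>v q. sweedler 1 (\<lambda>a b. F (a * S q) (b * S v)))"
    by (subst cancel_antipode_left(2)[where t = t]) (intro intros | simp)+
  also have "\<dots> = sweedler x (\<lambda>u v. F (S v) (S u))"
    by (subst sweedler_one[where t = t]) (intro intros | simp)+
  finally show ?thesis .
qed

lemma antipode_one: "S 1 = 1"
proof -
  have "sweedler 1 (\<lambda>u v. S u * v) = S 1 * 1"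
    by (subst sweedler_one[where t = scale]) (intro linear_intros | simp)+
  then show ?thesis
    using antipode_left[of 1] by (simp add: sweedler_def counit_one)
qed

text \<open>
  The identity behind the \<open>H\<close>-linearity of the averaged projection. In Sweedler notation the left
  side is \<open>K (S(S(h\<^sub>1) h\<^sub>2)) h\<^sub>3 (h\<^sub>4 S(h\<^sub>5))\<close>; its nesting is the one that arises when the coaction
  formula for \<open>act h m\<close> is applied twice.
\<close>

lemma conjugation_cancel:
  assumes K: "\<And>v w. Vector_Spaces.linear scale t (\<lambda>u. K u v w)"
    "\<And>u w. Vector_Spaces.linear scale t (\<lambda>v. K u v w)" "\<And>u v. Vector_Spaces.linear scale t (K u v)"
  shows "sweedler h (\<lambda>h1 h'. sweedler h' (\<lambda>h2 h3. sweedler h2 (\<lambda>a h''. sweedler h'' (\<lambda>b c.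
      K (S (S h1 * a)) b (c * S h3))))) = K 1 h 1"
proof -
  note intros = linear_compose_fun[OF K(1)] linear_compose_fun[OF K(2)] linear_compose_fun[OF K(3)]
    linear_intros linearD(6)[OF K(1)]
  have "sweedler h (\<lambda>h1 h'. sweedler h' (\<lambda>h2 h3. sweedler h2 (\<lambda>a h''. sweedler h'' (\<lambda>b c.
      K (S (S h1 * a)) b (c * S h3))))) =
    sweedler h (\<lambda>h1 h'. sweedler h' (\<lambda>a w. sweedler w (\<lambda>h'' h3. sweedler h'' (\<lambda>b c.
      K (S (S h1 * a)) b (c * S h3)))))"
    by (subst sweedler_coassoc[where t = t]) (intro intros | simp)+
  also have "\<dots> = sweedler h (\<lambda>h1 h'. sweedler h' (\<lambda>a w. K (S (S h1 * a)) w 1))"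
    by (subst cancel_antipode_right(2)[where t = t]) (intro intros | simp)+
  also have "\<dots> = K 1 h 1"
    by (subst cancel_antipode_left(2)[where t = t]) (intro intros | simp add: antipode_one)+
  finally show ?thesis .
qed

text \<open>
  The form \<open>(x, m) \<mapsto> \<phi>(x S(m))\<close> is a coseparability form:
  \<open>x\<^sub>1 \<phi>(x\<^sub>2 S(m)) = m\<^sub>2 \<phi>(x S(m\<^sub>1))\<close>. Indeed the right side is
  \<open>m\<^sub>2 (x S(m\<^sub>1))\<^sub>1 \<phi>((x S(m\<^sub>1))\<^sub>2) = x\<^sub>1 S(m\<^sub>2) m\<^sub>3 \<phi>(x\<^sub>2 S(m\<^sub>1))\<close> by invariance.
  This will make the averaged projection colinear.
\<close>

lemma invariant_functional_antipode:
  assumes \<phi>: "Vector_Spaces.linear scale (*) \<phi>"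
    and inv: "\<And>x. sweedler x (\<lambda>u v. scale (\<phi> v) u) = scale (\<phi> x) 1"
  shows "sweedler x (\<lambda>u v. scale (\<phi> (v * S m)) u) = sweedler m (\<lambda>u v. scale (\<phi> (x * S u)) v)"
proof -
  note intros = linear_compose_fun[OF \<phi>] linear_intros
  have "sweedler m (\<lambda>u v. scale (\<phi> (x * S u)) v) =
    sweedler m (\<lambda>u v. sweedler x (\<lambda>a b. sweedler u (\<lambda>c d. scale (\<phi> (b * S c)) (a * (S d * v)))))"
  proof (rule sweedler_cong)
    fix u v
    have "scale (\<phi> (x * S u)) v = sweedler (x * S u) (\<lambda>p q. scale (\<phi> q) p) * v"
      by (simp add: inv scale_mult_left)
    also have "\<dots> = sweedler (x * S u) (\<lambda>p q. scale (\<phi> q) (p * v))"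
      by (subst linear_sweedler[where t = scale and s = scale]) (intro intros | simp add: scale_mult_left)+
    also have "\<dots> = sweedler x (\<lambda>a b. sweedler u (\<lambda>c d. scale (\<phi> (b * S c)) (a * (S d * v))))"
      by (subst sweedler_mult[where t = scale], (intro intros)+)
        (subst antipode_comult[where t = scale], (intro intros | simp add: mult_ac)+)
    finally show "scale (\<phi> (x * S u)) v =
      sweedler x (\<lambda>a b. sweedler u (\<lambda>c d. scale (\<phi> (b * S c)) (a * (S d * v))))" .
  qed
  also have "\<dots> = sweedler x (\<lambda>a b. sweedler m (\<lambda>u v. sweedler u (\<lambda>c d. scale (\<phi> (b * S c)) (a * (S d * v)))))"
    by (rule sweedler_swap)
  also have "\<dots> = sweedler x (\<lambda>a b. scale (\<phi> (b * S m)) a)"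
    by (subst cancel_antipode_left_of_right(2)[where t = scale]) (intro intros | simp)+
  finally show ?thesis by simp
qed

text \<open>
  The dual of the preceding lemma: \<open>t\<^sub>1 \<otimes> S(t\<^sub>2)\<close> is a separability element,
  \<open>h t\<^sub>1 \<otimes> S(t\<^sub>2) = t\<^sub>1 \<otimes> S(t\<^sub>2) h\<close>, because
  \<open>h\<^sub>1 t\<^sub>1 \<otimes> S(h\<^sub>2 t\<^sub>2) h\<^sub>3 = \<epsilon>(h\<^sub>1) t\<^sub>1 \<otimes> S(t\<^sub>2) h\<^sub>2\<close>.
  It makes an averaged linear map commute with the action of \<open>H\<close>.
\<close>

lemma integral_commutes:
  assumes t: "\<And>h. h * t = scale (\<epsilon> h) t"
    and K: "\<And>v. Vector_Spaces.linear scale s (\<lambda>u. K u v)" "\<And>u. Vector_Spaces.linear scale s (K u)"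
  shows "sweedler t (\<lambda>u v. K (h * u) (S v)) = sweedler t (\<lambda>u v. K u (S v * h))"
proof -
  note intros = linear_compose_fun[OF K(1)] linear_compose_fun[OF K(2)] linear_intros linearD(6)[OF K(1)]
  have "sweedler t (\<lambda>u v. K u (S v * h)) = sweedler h (\<lambda>a b. s (\<epsilon> a) (sweedler t (\<lambda>u v. K u (S v * b))))"
    by (subst sweedler_counit_left[where t = s]) (intro intros | simp)+
  also have "\<dots> = sweedler h (\<lambda>a b. sweedler (a * t) (\<lambda>u v. K u (S v * b)))"
  proof (rule sweedler_cong)
    fix a b
    have "Vector_Spaces.linear scale s (\<lambda>x. sweedler x (\<lambda>u v. K u (S v * b)))"
      by (intro intros)+
    from linearD(2)[OF this]
    show "s (\<epsilon> a) (sweedler t (\<lambda>u v. K u (S v * b))) = sweedler (a * t) (\<lambda>u v. K u (S v * b))"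
      by (simp add: t)
  qed
  also have "\<dots> = sweedler h (\<lambda>a b. sweedler a (\<lambda>c d. sweedler t (\<lambda>u v. K (c * u) (S v * (S d * b)))))"
    by (subst sweedler_mult[where t = s]) (intro intros | simp add: antipode_mult mult_ac)+
  also have "\<dots> = sweedler t (\<lambda>u v. K (h * u) (S v))"
    by (subst cancel_antipode_left_of_right(2)[where t = s]) (intro intros | simp)+
  finally show ?thesis by simp
qed

text \<open>
  Some summand \<open>N\<close> of \<open>H\<close> contains an element outside the kernel of \<open>\<epsilon>\<close>. As \<open>N\<close> is a simple ideal, it
  meets the ideal \<open>ker \<epsilon>\<close> trivially. Now \<open>h t - \<epsilon>(h) t\<close> lies in both for \<open>t \<in> N\<close>.
\<close>

lemma normalized_integral:
  assumes "semisimple_ring TYPE('h)"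
  obtains t where "\<And>h. h * t = scale (\<epsilon> h) t" "\<epsilon> t = 1"
proof -
  interpret R: module "(*) :: 'h \<Rightarrow> 'h \<Rightarrow> 'h"
    by unfold_locales (simp_all add: algebra_simps)
  obtain \<N> :: "'h set set" where simple: "\<And>N. N \<in> \<N> \<Longrightarrow> R.simple_submodule N" and sum: "is_direct_sum \<N>"
    using assms unfolding semisimple_ring_def R.semisimple_module_def by blast
  obtain f where f: "\<And>N. N \<in> \<N> \<Longrightarrow> f N \<in> N" "\<And>N. f N \<noteq> 0 \<Longrightarrow> N \<in> \<N>" "1 = (\<Sum>N | f N \<noteq> 0. f N)"
    using sum[unfolded is_direct_sum_def, THEN spec, of 1] by metis
  interpret E: Vector_Spaces.linear scale "(*)" \<epsilon> by (rule counit_linear)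
  have "(\<Sum>N | f N \<noteq> 0. \<epsilon> (f N)) \<noteq> 0"
    using counit_one f(3) by (metis E.sum zero_neq_one)
  then obtain N where N: "f N \<noteq> 0" "\<epsilon> (f N) \<noteq> 0"
    by (metis (mono_tags, lifting) mem_Collect_eq sum.neutral)
  then have mem: "f N \<in> N" "R.simple_submodule N"
    using f simple by blast+
  have N_simple: "R.subspace N" "\<And>L. R.subspace L \<Longrightarrow> L \<subseteq> N \<Longrightarrow> L = {0} \<or> L = N"
    using mem(2) unfolding R.simple_submodule_def by blast+
  have "R.subspace {x \<in> N. \<epsilon> x = 0}"
    using N_simple(1) by (auto simp: R.subspace_def E.add E.zero counit_mult)
  then have ker: "{x \<in> N. \<epsilon> x = 0} = {0}"
    using N_simple(2)[of "{x \<in> N. \<epsilon> x = 0}"] N(2) mem(1) by blast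
  define t where "t = scale (1 / \<epsilon> (f N)) (f N)"
  have "t = scale (1 / \<epsilon> (f N)) 1 * f N"
    by (simp add: t_def scale_mult_left)
  then have "t \<in> N"
    using N_simple(1) mem(1) R.subspace_scale by metis
  have "\<epsilon> t = 1"
    using N by (simp add: t_def E.scale)
  moreover have "h * t = scale (\<epsilon> h) t" for h
  proof -
    have "h * t - scale (\<epsilon> h) 1 * t \<in> N"
      using \<open>t \<in> N\<close> N_simple(1) by (intro R.subspace_diff R.subspace_scale)
    moreover have "\<epsilon> (h * t - scale (\<epsilon> h) 1 * t) = 0"
      by (simp add: E.diff E.scale counit_mult counit_one)
    ultimately have "h * t - scale (\<epsilon> h) 1 * t = 0" using ker by blast
    then show ?thesis by (simp add: scale_mult_left)
  qed
  ultimately show ?thesis using that by blast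
qed

end

section \<open>Comodules as modules over the dual algebra\<close>

context right_comodule
begin

definition cosweedler :: "'m \<Rightarrow> ('m \<Rightarrow> 'c \<Rightarrow> 'z) \<Rightarrow> 'z::ab_group_add" where
  "cosweedler m F = (\<Sum>(m0, m1)\<leftarrow>\<rho> m. F m0 m1)"

text \<open>
  A comodule is a module over the convolution algebra of functionals, with \<open>f\<close> acting by
  \<open>m \<mapsto> f(m\<^sub>1) m\<^sub>0\<close>.
\<close>

definition dual_act :: "('c \<Rightarrow> 'k) \<Rightarrow> 'm \<Rightarrow> 'm" where
  "dual_act f m = cosweedler m (\<lambda>m0 m1. scaleM (f m1) m0)"

definition dual_orbit :: "'m \<Rightarrow> 'm set" where
  "dual_orbit x = {dual_act g x | g. Vector_Spaces.linear scale (*) g}"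

lemmas comodule_linear_intros [linear_intros] =
  V.vector_space_axioms V.linear_ident V.linear_scale_left V.linear_scale_right

lemma cosweedler_linear [linear_intros]:
  assumes g: "Vector_Spaces.linear s scaleM g"
    and F: "\<And>v. Vector_Spaces.linear scaleM t (\<lambda>u. F u v)" "\<And>u. Vector_Spaces.linear scale t (F u)"
  shows "Vector_Spaces.linear s t (\<lambda>x. cosweedler (g x) F)"
proof (rule linear_compose_fun[OF _ g, of t "\<lambda>x. cosweedler x F"], rule linearI)
  show "vector_space t" using F(1) by (rule linearD)
  show "cosweedler (x + y) F = cosweedler x F + cosweedler y F" for x y
    unfolding cosweedler_def using tensor_eq_eval[OF coact_add F] by simp
  show "cosweedler (scaleM a x) F = t a (cosweedler x F)" for a x
    unfolding cosweedler_def using tensor_eq_eval[OF coact_scale F, of a x]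
    by (simp add: linear_sum_list[OF vector_space.linear_scale_right[OF \<open>vector_space t\<close> vector_space.linear_ident[OF \<open>vector_space t\<close>]]]
        linearD(2)[OF F(1)] case_prod_unfold o_def)
qed (rule V.vector_space_axioms)

lemma cosweedler_linear_body [linear_intros]:
  assumes "vector_space s" "vector_space t" "\<And>u v. Vector_Spaces.linear s t (\<lambda>x. F x u v)"
  shows "Vector_Spaces.linear s t (\<lambda>x. cosweedler c (F x))"
  unfolding cosweedler_def by (intro sum_list_linear assms)

lemma linear_cosweedler:
  "Vector_Spaces.linear s t g \<Longrightarrow> g (cosweedler m F) = cosweedler m (\<lambda>u v. g (F u v))"
  unfolding cosweedler_def by (subst linear_sum_list) (auto simp: case_prod_unfold)

lemma cosweedler_cong: "(\<And>u v. F u v = G u v) \<Longrightarrow> cosweedler m F = cosweedler m G"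
  by (simp add: cosweedler_def)

lemma cosweedler_sweedler_swap:
  "cosweedler m (\<lambda>u v. C.sweedler x (\<lambda>a b. F u v a b)) = C.sweedler x (\<lambda>a b. cosweedler m (\<lambda>u v. F u v a b))"
  unfolding cosweedler_def by (rule C.sweedler_swap_list[symmetric])

lemma cosweedler_coassoc:
  assumes "\<And>v w. Vector_Spaces.linear scaleM t (\<lambda>u. G u v w)"
    "\<And>u w. Vector_Spaces.linear scale t (\<lambda>v. G u v w)" "\<And>u v. Vector_Spaces.linear scale t (G u v)"
  shows "cosweedler m (\<lambda>u v. cosweedler u (\<lambda>p q. G p q v)) = cosweedler m (\<lambda>u v. C.sweedler v (\<lambda>p q. G u p q))"
  using tensor3_eq_eval[OF coact_coassoc assms, of m]
  by (simp add: cosweedler_def C.sweedler_def sum_list_concat_map case_prod_unfold o_def)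

lemma cosweedler_counit:
  assumes "Vector_Spaces.linear scaleM t g"
  shows "cosweedler m (\<lambda>u v. t (\<epsilon> v) (g u)) = g m"
  using linear_cosweedler[OF assms, of m "\<lambda>u v. scaleM (\<epsilon> v) u"] coact_counit[of m]
  by (simp add: cosweedler_def linearD(2)[OF assms])

lemma dual_act_linear:
  assumes "Vector_Spaces.linear scale (*) f"
  shows "Vector_Spaces.linear scaleM scaleM (dual_act f)"
  unfolding dual_act_def by (intro linear_intros assms)+

lemma dual_act_counit: "dual_act \<epsilon> m = m"
  unfolding dual_act_def by (subst cosweedler_counit) (intro linear_intros | simp)+

lemma dual_act_dual_act:
  assumes f: "Vector_Spaces.linear scale (*) f" and g: "Vector_Spaces.linear scale (*) g"
  shows "dual_act f (dual_act g m) = dual_act (\<lambda>x. C.sweedler x (\<lambda>u v. f u * g v)) m"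
proof -
  note intros = linear_compose_fun[OF f] linear_compose_fun[OF g] linear_intros
  have "dual_act f (dual_act g m) = cosweedler m (\<lambda>m0 m1. scaleM (g m1) (dual_act f m0))"
    unfolding dual_act_def[of g] using linear_cosweedler[OF dual_act_linear[OF f]]
    by (simp add: linearD(2)[OF dual_act_linear[OF f]])
  also have "\<dots> = cosweedler m (\<lambda>m0 m1. cosweedler m0 (\<lambda>p q. scaleM (g m1) (scaleM (f q) p)))"
    unfolding dual_act_def
    by (subst linear_cosweedler[where s = scaleM and t = scaleM]) (intro intros | simp)+
  also have "\<dots> = cosweedler m (\<lambda>m0 m1. C.sweedler m1 (\<lambda>p q. scaleM (g q) (scaleM (f p) m0)))"
    by (subst cosweedler_coassoc[where t = scaleM]) (intro intros | simp)+
  also have "\<dots> = dual_act (\<lambda>x. C.sweedler x (\<lambda>u v. f u * g v)) m"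
    unfolding dual_act_def
    by (subst C.linear_sweedler[where g = "\<lambda>a. scaleM a _" and s = "(*)" and t = scaleM])
      (intro intros vector_space.linear_ident | simp add: mult.commute)+
  finally show ?thesis .
qed

text \<open>
  The elements \<open>dual_act f n\<close> are the slices of \<open>\<rho> n\<close>, and slices detect membership in \<open>N \<otimes> C\<close>.
\<close>

lemma subcomodule_iff_dual_act:
  "subcomodule N \<longleftrightarrow> V.subspace N \<and>
     (\<forall>f. Vector_Spaces.linear scale (*) f \<longrightarrow> (\<forall>n\<in>N. dual_act f n \<in> N))"
proof (intro iffI conjI allI impI ballI)
  assume N: "subcomodule N"
  then show sub: "V.subspace N" by (simp add: subcomodule_def)
  fix f n assume f: "Vector_Spaces.linear scale (*) f" and n: "n \<in> N"
  obtain ys where ys: "set ys \<subseteq> N \<times> UNIV" "tensor_eq scaleM scale (\<rho> n) ys"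
    using N n unfolding subcomodule_def by blast
  have "dual_act f n = (\<Sum>(u, v)\<leftarrow>ys. scaleM (f v) u)"
    unfolding dual_act_def cosweedler_def
    by (rule tensor_eq_eval[OF ys(2), where t = scaleM]) (intro linear_compose_fun[OF f] linear_intros)+
  also have "\<dots> \<in> N"
    using ys(1) by (induction ys) (auto intro: V.subspace_0 V.subspace_add V.subspace_scale sub)
  finally show "dual_act f n \<in> N" .
next
  assume N: "V.subspace N \<and> (\<forall>f. Vector_Spaces.linear scale (*) f \<longrightarrow> (\<forall>n\<in>N. dual_act f n \<in> N))"
  have "\<exists>ys. set ys \<subseteq> N \<times> UNIV \<and> tensor_eq scaleM scale (\<rho> n) ys" if "n \<in> N" for n
  proof -
    have "(\<Sum>(v, w)\<leftarrow>\<rho> n. scaleM (f w) v) \<in> N" if "Vector_Spaces.linear scale (*) f" for f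
      using N \<open>n \<in> N\<close> that by (simp add: dual_act_def cosweedler_def)
    then show ?thesis
      using tensor_eq_supported[OF V.vector_space_axioms C.vector_space_axioms, of "\<rho> n" N] by metis
  qed
  then show "subcomodule N" using N by (simp add: subcomodule_def)
qed

end

section \<open>Yetter-Drinfeld modules\<close>

sublocale yetter_drinfeld_module \<subseteq> H: commutative_hopf_algebra scale \<Delta> \<epsilon> S
  by unfold_locales

context yetter_drinfeld_module
begin

lemma scaleM_eq_act: "scaleM a m = act (scale a 1) m"
  by (simp add: act_scale)

lemma act_scaleM: "act h (scaleM a m) = scaleM a (act h m)"
  by (simp add: scaleM_eq_act H.scale_mult_left H.scale_mult_right mult.commute)

lemma act_linear [linear_intros]:
  "Vector_Spaces.linear s scaleM g \<Longrightarrow> Vector_Spaces.linear s scaleM (\<lambda>x. act h (g x))"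
  "Vector_Spaces.linear s scale g' \<Longrightarrow> Vector_Spaces.linear s scaleM (\<lambda>x. act (g' x) m)"
  by (auto simp: Vector_Spaces.linear_iff A.scale_left_distrib A.scale_right_distrib act_scale act_scaleM V.vector_space_axioms)

lemma subspace_if_submodule: "A.subspace N \<Longrightarrow> V.subspace N"
  by (auto simp: A.subspace_def V.subspace_def scaleM_eq_act)

lemma subobject_iff:
  "subobject N \<longleftrightarrow> A.subspace N \<and>
     (\<forall>f. Vector_Spaces.linear scale (*) f \<longrightarrow> (\<forall>n\<in>N. dual_act f n \<in> N))"
  using subspace_if_submodule by (auto simp: subobject_def subcomodule_iff_dual_act)

text \<open>
  The coaction formula \<open>\<rho>(h m) = h\<^sub>2 m\<^sub>0 \<otimes> h\<^sub>3 m\<^sub>1 S(h\<^sub>1)\<close>. It follows from the compatibility axiom for \<open>h\<^sub>2\<close>,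
  multiplied on the right by \<open>S(h\<^sub>1)\<close>. Commutativity enters here: the factor \<open>h\<^sub>2 S(h\<^sub>1)\<close> equals
  \<open>S(h\<^sub>1) h\<^sub>2\<close> and cancels, so that \<open>S\<close> may replace its inverse.
\<close>

lemma cosweedler_act:
  assumes F: "\<And>v. Vector_Spaces.linear scaleM t (\<lambda>u. F u v)" "\<And>u. Vector_Spaces.linear scale t (F u)"
  shows "cosweedler (act h m) F =
    H.sweedler h (\<lambda>h1 h'. H.sweedler h' (\<lambda>h2 h3. cosweedler m (\<lambda>m0 m1. F (act h2 m0) (h3 * m1 * S h1))))"
proof -
  note intros = linear_compose_fun[OF F(1)] linear_compose_fun[OF F(2)] linear_intros linearD(6)[OF F(1)]
  have yd: "H.sweedler h' (\<lambda>h2 h3. cosweedler m (\<lambda>m0 m1. F (act h2 m0) (h3 * m1 * c))) =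
      H.sweedler h' (\<lambda>h2 h3. cosweedler (act h3 m) (\<lambda>m0 m1. F m0 (m1 * h2 * c)))" for h' c
  proof -
    have "Vector_Spaces.linear scaleM t (\<lambda>u. F u (w * c))" "Vector_Spaces.linear scale t (\<lambda>w. F u (w * c))"
      for u w by (intro intros)+
    from tensor_eq_eval[OF yetter_drinfeld[of m h'] this] show ?thesis
      by (simp add: cosweedler_def H.sweedler_def sum_list_concat_map case_prod_unfold o_def)
  qed
  have "cosweedler (act h m) F =
      H.sweedler h (\<lambda>h1 h'. H.sweedler h' (\<lambda>h2 h3. cosweedler (act h3 m) (\<lambda>m0 m1. F m0 (m1 * (S h1 * h2)))))"
    by (subst H.cancel_antipode_left(2)[where t = t]) (intro intros | simp)+
  also have "\<dots> = H.sweedler h (\<lambda>h1 h'. H.sweedler h' (\<lambda>h2 h3. cosweedler (act h3 m) (\<lambda>m0 m1. F m0 (m1 * h2 * S h1))))"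
    by (simp add: mult_ac)
  finally show ?thesis by (simp only: yd)
qed

section \<open>Splitting subobjects\<close>

text \<open>
  Average a \<open>k\<close>-linear projection \<open>q\<close> with the integral: \<open>p(m) = t\<^sub>1 q(S(t\<^sub>2) m)\<close>.
\<close>

lemma exists_module_projection:
  assumes t: "\<And>h. h * t = scale (\<epsilon> h) t" "\<epsilon> t = 1" and N: "A.subspace N"
  obtains p where "Vector_Spaces.linear scaleM scaleM p" "\<And>h m. p (act h m) = act h (p m)"
    "\<And>m. p m \<in> N" "\<And>n. n \<in> N \<Longrightarrow> p n = n"
proof -
  obtain q where q: "Vector_Spaces.linear scaleM scaleM q" "range q \<subseteq> N" "\<And>n. n \<in> N \<Longrightarrow> q n = n"
    using V.exists_linear_projection[OF subspace_if_submodule[OF N]] by blast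
  note intros = linear_compose_fun[OF q(1)] linear_intros
  define p where "p m = H.sweedler t (\<lambda>u v. act u (q (act (S v) m)))" for m
  have "Vector_Spaces.linear scaleM scaleM p"
    unfolding p_def by (intro intros)
  moreover have "p (act h m) = act h (p m)" for h m
  proof -
    have "act h (p m) = H.sweedler t (\<lambda>u v. act (h * u) (q (act (S v) m)))"
      unfolding p_def by (subst H.linear_sweedler[where s = scaleM and t = scaleM]) (intro intros | simp)+
    also have "\<dots> = H.sweedler t (\<lambda>u v. act u (q (act (S v * h) m)))"
      by (rule H.integral_commutes[OF t(1), where s = scaleM]) (intro intros)+
    finally show ?thesis by (simp add: p_def)
  qed
  moreover have "p m \<in> N" for m
  proof -
    have "(\<Sum>(u, v)\<leftarrow>xs. act u (q (act (S v) m))) \<in> N" for xs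
      by (induction xs) (use q(2) N in \<open>auto intro: A.subspace_0 A.subspace_add A.subspace_scale\<close>)
    then show ?thesis by (simp add: p_def H.sweedler_def)
  qed
  moreover have "p n = n" if "n \<in> N" for n
  proof -
    have "p n = H.sweedler t (\<lambda>u v. act (u * S v) n)"
      unfolding p_def using q(3) A.subspace_scale[OF N that] by simp
    also have "\<dots> = scaleM (\<epsilon> t) (act 1 n)"
      by (rule H.sweedler_antipode_right) (intro intros)
    finally show ?thesis by (simp add: t)
  qed
  ultimately show ?thesis using that by blast
qed

text \<open>
  Average an \<open>H\<close>-linear projection \<open>p\<close> with the invariant functional:
  \<open>P(m) = \<phi>(p(m\<^sub>0)\<^sub>1 S(m\<^sub>1)) p(m\<^sub>0)\<^sub>0\<close>. This is colinear because \<open>\<phi>(x S(m))\<close> is a coseparability form.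
  It is still \<open>H\<close>-linear: replacing \<open>m\<close> by \<open>h m\<close> multiplies the argument of \<open>\<phi>\<close> by
  \<open>h\<^sub>4 S(h\<^sub>2) S(h\<^sub>5 S(h\<^sub>1))\<close> and puts \<open>h\<^sub>3\<close> in front, and in a commutative Hopf algebra the outer
  factors cancel in pairs.
\<close>

lemma exists_yetter_drinfeld_projection:
  assumes t: "\<And>h. h * t = scale (\<epsilon> h) t" "\<epsilon> t = 1"
    and \<phi>: "Vector_Spaces.linear scale (*) \<phi>" "\<phi> 1 = 1"
      "\<And>x. H.sweedler x (\<lambda>u v. scale (\<phi> v) u) = scale (\<phi> x) 1"
    and N: "subobject N"
  obtains P where "Vector_Spaces.linear scaleM scaleM P" "\<And>h m. P (act h m) = act h (P m)"
    "\<And>f m. Vector_Spaces.linear scale (*) f \<Longrightarrow> P (dual_act f m) = dual_act f (P m)"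
    "\<And>m. P m \<in> N" "\<And>n. n \<in> N \<Longrightarrow> P n = n"
proof -
  have N_mod: "A.subspace N" and N_dual: "\<And>f n. Vector_Spaces.linear scale (*) f \<Longrightarrow> n \<in> N \<Longrightarrow> dual_act f n \<in> N"
    using N by (auto simp: subobject_iff)
  obtain p where p: "Vector_Spaces.linear scaleM scaleM p" "\<And>h m. p (act h m) = act h (p m)"
    "\<And>m. p m \<in> N" "\<And>n. n \<in> N \<Longrightarrow> p n = n"
    using exists_module_projection[OF t N_mod] by blast
  note intros = linear_compose_fun[OF p(1)] linear_compose_fun[OF \<phi>(1)] linear_intros
  define P where
    "P m = cosweedler m (\<lambda>m0 m1. cosweedler (p m0) (\<lambda>n0 n1. scaleM (\<phi> (n1 * S m1)) n0))" for m
  have P_lin: "Vector_Spaces.linear scaleM scaleM P"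
    unfolding P_def by (intro intros)+
  moreover have "P (act h m) = act h (P m)" for h m
  proof -
    have "P (act h m) = H.sweedler h (\<lambda>h1 h'. H.sweedler h' (\<lambda>h2 h3. cosweedler m (\<lambda>m0 m1.
        cosweedler (act h2 (p m0)) (\<lambda>n0 n1. scaleM (\<phi> (n1 * S (h3 * m1 * S h1))) n0))))"
      unfolding P_def by (subst cosweedler_act[where t = scaleM]) (intro intros | simp add: p(2))+
    also have "\<dots> = H.sweedler h (\<lambda>h1 h'. H.sweedler h' (\<lambda>h2 h3. cosweedler m (\<lambda>m0 m1.
        H.sweedler h2 (\<lambda>a h''. H.sweedler h'' (\<lambda>b c. cosweedler (p m0) (\<lambda>n0 n1.
          scaleM (\<phi> (c * n1 * S a * S (h3 * m1 * S h1))) (act b n0)))))))"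
      by (subst cosweedler_act[where t = scaleM]) (intro intros | simp)+
    also have "\<dots> = cosweedler m (\<lambda>m0 m1. cosweedler (p m0) (\<lambda>n0 n1.
        H.sweedler h (\<lambda>h1 h'. H.sweedler h' (\<lambda>h2 h3. H.sweedler h2 (\<lambda>a h''. H.sweedler h'' (\<lambda>b c.
          scaleM (\<phi> (n1 * S m1 * S (S h1 * a) * (c * S h3))) (act b n0)))))))"
      by (simp add: cosweedler_sweedler_swap H.antipode_mult mult_ac)
    also have "\<dots> = cosweedler m (\<lambda>m0 m1. cosweedler (p m0) (\<lambda>n0 n1.
        scaleM (\<phi> (n1 * S m1 * 1 * 1)) (act h n0)))"
    proof (intro cosweedler_cong)
      fix m0 m1 n0 n1
      show "H.sweedler h (\<lambda>h1 h'. H.sweedler h' (\<lambda>h2 h3. H.sweedler h2 (\<lambda>a h''. H.sweedler h'' (\<lambda>b c.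
          scaleM (\<phi> (n1 * S m1 * S (S h1 * a) * (c * S h3))) (act b n0))))) =
        scaleM (\<phi> (n1 * S m1 * 1 * 1)) (act h n0)"
        by (rule H.conjugation_cancel[where t = scaleM and
            K = "\<lambda>u b w. scaleM (\<phi> (n1 * S m1 * u * w)) (act b n0)"]) (intro intros)+
    qed
    also have "\<dots> = act h (P m)"
      unfolding P_def
      by (simp add: linear_cosweedler[OF act_linear(1)[OF V.linear_ident]] act_scaleM)
    finally show ?thesis .
  qed
  moreover have "P (dual_act f m) = dual_act f (P m)" if f: "Vector_Spaces.linear scale (*) f" for f m
  proof -
    note intros = linear_compose_fun[OF f] intros
    note act_f = dual_act_linear[OF f]
    have "dual_act f (P m) = cosweedler m (\<lambda>m0 m1. cosweedler (p m0) (\<lambda>n0 n1.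
        scaleM (\<phi> (n1 * S m1)) (dual_act f n0)))"
      unfolding P_def by (simp add: linear_cosweedler[OF act_f] linearD(2)[OF act_f])
    also have "\<dots> = cosweedler m (\<lambda>m0 m1. cosweedler (p m0) (\<lambda>n0 n1. cosweedler n0 (\<lambda>a b.
        scaleM (\<phi> (n1 * S m1)) (scaleM (f b) a))))"
      unfolding dual_act_def
      by (subst linear_cosweedler[where s = scaleM and t = scaleM and g = "scaleM _"]) (intro intros | simp)+
    also have "\<dots> = cosweedler m (\<lambda>m0 m1. cosweedler (p m0) (\<lambda>n0 n1. H.sweedler n1 (\<lambda>b c.
        scaleM (\<phi> (c * S m1)) (scaleM (f b) n0))))"
      by (subst cosweedler_coassoc[where t = scaleM]) (intro intros | simp)+
    also have "\<dots> = cosweedler m (\<lambda>m0 m1. cosweedler (p m0) (\<lambda>n0 n1. H.sweedler m1 (\<lambda>b c.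
        scaleM (\<phi> (n1 * S b)) (scaleM (f c) n0))))"
    proof (intro cosweedler_cong)
      fix m0 m1 n0 n1
      have lin: "Vector_Spaces.linear scale scaleM (\<lambda>x. scaleM (f x) n0)"
        by (intro intros)
      show "H.sweedler n1 (\<lambda>b c. scaleM (\<phi> (c * S m1)) (scaleM (f b) n0)) =
        H.sweedler m1 (\<lambda>b c. scaleM (\<phi> (n1 * S b)) (scaleM (f c) n0))"
        using arg_cong[OF H.invariant_functional_antipode[OF \<phi>(1,3), of n1 m1], of "\<lambda>x. scaleM (f x) n0"]
        by (simp add: H.linear_sweedler[OF lin] linearD(2)[OF lin] linearD(2)[OF f])
    qed
    also have "\<dots> = cosweedler m (\<lambda>m0 m1. H.sweedler m1 (\<lambda>b c. cosweedler (p m0) (\<lambda>n0 n1.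
        scaleM (f c) (scaleM (\<phi> (n1 * S b)) n0))))"
      by (simp add: cosweedler_sweedler_swap mult.commute)
    also have "\<dots> = cosweedler m (\<lambda>m0 m1. cosweedler m0 (\<lambda>a b. cosweedler (p a) (\<lambda>n0 n1.
        scaleM (f m1) (scaleM (\<phi> (n1 * S b)) n0))))"
      by (subst cosweedler_coassoc[where t = scaleM]) (intro intros | simp)+
    also have "\<dots> = cosweedler m (\<lambda>m0 m1. scaleM (f m1) (P m0))"
      unfolding P_def
      by (simp add: linear_cosweedler[OF V.linear_scale_right[OF V.linear_ident]])
    also have "\<dots> = P (dual_act f m)"
      unfolding dual_act_def by (simp add: linear_cosweedler[OF P_lin] linearD(2)[OF P_lin])
    finally show ?thesis by simp
  qed
  moreover have "P m \<in> N" for m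
  proof -
    have "(\<Sum>(m0, m1)\<leftarrow>xs. dual_act (\<lambda>y. \<phi> (y * S m1)) (p m0)) \<in> N" for xs
    proof (induction xs)
      case (Cons x xs)
      have "dual_act (\<lambda>y. \<phi> (y * S m1)) (p m0) \<in> N" for m0 m1
        by (rule N_dual[OF _ p(3)]) (intro intros)
      then show ?case
        using Cons A.subspace_add[OF N_mod] by (simp add: case_prod_unfold)
    qed (simp add: A.subspace_0[OF N_mod])
    then show ?thesis by (simp add: P_def cosweedler_def dual_act_def)
  qed
  moreover have "P n = n" if n: "n \<in> N" for n
  proof -
    obtain ys where ys: "set ys \<subseteq> N \<times> UNIV" "tensor_eq scaleM scale (\<rho> n) ys"
      using N n unfolding subobject_def subcomodule_def by blast
    \<comment> \<open>Represent \<open>\<rho> n\<close> by a sum over \<open>N \<otimes> H\<close>, on which \<open>p\<close> is the identity.\<close>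
    have "P n = (\<Sum>(m0, m1)\<leftarrow>ys. cosweedler (p m0) (\<lambda>n0 n1. scaleM (\<phi> (n1 * S m1)) n0))"
      unfolding P_def cosweedler_def[of n]
      by (rule tensor_eq_eval[OF ys(2), where t = scaleM]) (intro intros)+
    also have "\<dots> = (\<Sum>(m0, m1)\<leftarrow>ys. cosweedler m0 (\<lambda>n0 n1. scaleM (\<phi> (n1 * S m1)) n0))"
      using ys(1) by (induction ys) (auto simp: p(4))
    also have "\<dots> = cosweedler n (\<lambda>m0 m1. cosweedler m0 (\<lambda>n0 n1. scaleM (\<phi> (n1 * S m1)) n0))"
      unfolding cosweedler_def[of n]
      by (rule tensor_eq_eval[OF ys(2), where t = scaleM, symmetric]) (intro intros)+
    also have "\<dots> = cosweedler n (\<lambda>m0 m1. H.sweedler m1 (\<lambda>u v. scaleM (\<phi> (u * S v)) m0))"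
      by (subst cosweedler_coassoc[where t = scaleM]) (intro intros | simp)+
    also have "\<dots> = cosweedler n (\<lambda>m0 m1. scaleM (\<epsilon> m1) (scaleM (\<phi> 1) m0))"
      by (subst H.sweedler_antipode_right[where t = scaleM and g = "\<lambda>x. scaleM (\<phi> x) _"]) (intro intros | simp)+
    also have "\<dots> = n"
      by (subst cosweedler_counit) (intro intros | simp add: \<phi>(2))+
    finally show ?thesis .
  qed
  ultimately show ?thesis using that by blast
qed

section \<open>Finite generation of simple subobjects\<close>

text \<open>
  The dual orbit of \<open>x\<close> is closed under functionals, and by the coaction formula
  \<open>f(h m)\<close> for the dual action is a sum of terms \<open>h\<^sub>2\<close> applied to dual translates of \<open>m\<close>. So closure
  under functionals spreads to the \<open>H\<close>-submodule that the orbit generates.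
\<close>

lemma submodule_generated_by_dual_orbit_is_subobject:
  "subobject (A.span (dual_orbit x))"
proof -
  let ?W = "A.span (dual_orbit x)"
  \<comment> \<open>The elements all of whose dual translates lie in the submodule form a submodule themselves.\<close>
  let ?Y = "{m. \<forall>f. Vector_Spaces.linear scale (*) f \<longrightarrow> dual_act f m \<in> ?W}"
  have "?W \<subseteq> ?Y"
  proof (rule A.span_minimal)
    show "dual_orbit x \<subseteq> ?Y"
      unfolding dual_orbit_def
    proof safe
      fix f g assume f: "Vector_Spaces.linear scale (*) f" and g: "Vector_Spaces.linear scale (*) g"
      have "Vector_Spaces.linear scale (*) (\<lambda>x. H.sweedler x (\<lambda>u v. f u * g v))"
        by (intro linear_compose_fun[OF f] linear_compose_fun[OF g] linear_intros
            vector_space.linear_scale_left[OF vector_space_mult] vector_space.linear_scale_right[OF vector_space_mult])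
      then show "dual_act f (dual_act g x) \<in> A.span {dual_act g x | g. Vector_Spaces.linear scale (*) g}"
        unfolding dual_act_dual_act[OF f g] by (intro A.span_base) (auto simp: dual_orbit_def)
    qed
    show "A.subspace ?Y"
      unfolding A.subspace_def
    proof (intro conjI ballI allI)
      show "0 \<in> ?Y"
        by (simp add: linearD(3)[OF dual_act_linear] A.span_zero)
      show "m + n \<in> ?Y" if "m \<in> ?Y" "n \<in> ?Y" for m n
        using that by (simp add: linearD(1)[OF dual_act_linear] A.span_add)
      show "act h m \<in> ?Y" if m: "m \<in> ?Y" for h m
      proof safe
        fix f assume f: "Vector_Spaces.linear scale (*) f"
        note intros = linear_compose_fun[OF f] linear_intros
        have lin: "Vector_Spaces.linear scale (*) (\<lambda>y. f (h3 * y * S h1))" for h1 h3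
          by (intro intros)
        have "dual_act f (act h m) = H.sweedler h (\<lambda>h1 h'. H.sweedler h' (\<lambda>h2 h3.
            cosweedler m (\<lambda>m0 m1. scaleM (f (h3 * m1 * S h1)) (act h2 m0))))"
          unfolding dual_act_def by (subst cosweedler_act[where t = scaleM]) (intro intros | simp)+
        also have "\<dots> = H.sweedler h (\<lambda>h1 h'. H.sweedler h' (\<lambda>h2 h3.
            act h2 (dual_act (\<lambda>y. f (h3 * y * S h1)) m)))"
          unfolding dual_act_def
          by (subst linear_cosweedler[where s = scaleM and t = scaleM and g = "act _"])
            (intro intros | simp add: act_scaleM)+
        also have "\<dots> \<in> ?W"
        proof -
          have mem: "act h2 (dual_act (\<lambda>y. f (h3 * y * S h1)) m) \<in> ?W" for h1 h2 h3
            using m lin[of h3 h1] by (intro A.span_scale) blast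
          have inner: "(\<Sum>(h2, h3)\<leftarrow>ys. act h2 (dual_act (\<lambda>y. f (h3 * y * S h1)) m)) \<in> ?W" for ys h1
          proof (induction ys)
            case (Cons y ys)
            then show ?case using A.span_add[OF mem] by (simp add: case_prod_unfold)
          qed (simp add: A.span_zero)
          have "(\<Sum>(h1, h')\<leftarrow>xs. \<Sum>(h2, h3)\<leftarrow>\<Delta> h'. act h2 (dual_act (\<lambda>y. f (h3 * y * S h1)) m)) \<in> ?W" for xs
          proof (induction xs)
            case (Cons x xs)
            then show ?case using A.span_add[OF inner] by (simp add: case_prod_unfold)
          qed (simp add: A.span_zero)
          then show ?thesis by (simp add: H.sweedler_def)
        qed
        finally show "dual_act f (act h m) \<in> ?W" .
      qed
    qed
  qed
  then show ?thesis
    by (auto simp: subobject_iff)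
qed

text \<open>
  The dual orbit lies in the \<open>k\<close>-span of the finitely many left factors of \<open>\<rho> x\<close>, so it is spanned by
  finitely many of its own elements. The left factors themselves need not be used as generators:
  for an arbitrary representative of \<open>\<rho> x\<close> they may lie outside the submodule.
\<close>

lemma finitely_generated_dual_orbit:
  "A.finitely_generated (A.span (dual_orbit x))"
proof -
  let ?X = "dual_orbit x" and ?F = "fst ` set (\<rho> x)"
  obtain B where B: "B \<subseteq> ?X" "V.independent B" "?X \<subseteq> V.span B"
    by (rule V.maximal_independent_subset)
  have "(\<Sum>(m0, m1)\<leftarrow>xs. scaleM (g m1) m0) \<in> V.span ?F" if "set xs \<subseteq> set (\<rho> x)" for xs g
    using that
  proof (induction xs)
    case (Cons y ys)
    then have "fst y \<in> V.span ?F" by (intro V.span_base) auto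
    then show ?case
      using Cons by (auto simp: case_prod_unfold intro!: V.span_add V.span_scale)
  qed (simp add: V.span_zero)
  then have "?X \<subseteq> V.span ?F"
    by (auto simp: dual_orbit_def dual_act_def cosweedler_def)
  then have "finite B"
    using V.independent_span_bound[of ?F B] B by auto
  moreover have "V.span B \<subseteq> A.span B"
    by (intro V.span_minimal A.span_superset subspace_if_submodule A.subspace_span)
  then have "A.span ?X = A.span B"
    using B by (intro A.span_eq[THEN iffD2]) (auto intro: A.span_base)
  ultimately show ?thesis
    unfolding A.finitely_generated_def by blast
qed

text \<open>
  A simple subobject is generated, as a subobject, by the dual orbit of any of its nonzero elements.
\<close>

lemma simple_subobject_finitely_generated:
  assumes N: "simple_subobject N"
  shows "A.finitely_generated N"
proof -
  have sub: "subobject N" and N0: "N \<noteq> {0}"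
    using N by (auto simp: simple_subobject_def)
  have N_mod: "A.subspace N"
    using sub by (simp add: subobject_def)
  then obtain x where x: "x \<in> N" "x \<noteq> 0"
    using N0 A.subspace_0 by blast
  let ?W = "A.span (dual_orbit x)"
  have "x \<in> dual_orbit x"
    unfolding dual_orbit_def
    using H.counit_linear dual_act_counit[of x] by (metis (mono_tags, lifting) mem_Collect_eq)
  then have "x \<in> ?W" by (rule A.span_base)
  moreover have "?W \<subseteq> N"
    using sub x by (intro A.span_minimal N_mod) (auto simp: subobject_iff dual_orbit_def)
  ultimately have "?W = N"
    using N x submodule_generated_by_dual_orbit_is_subobject[of x] unfolding simple_subobject_def by blast
  then show ?thesis using finitely_generated_dual_orbit[of x] by simp
qed

section \<open>Decomposition into simple subobjects\<close>

definition operators :: "('m \<Rightarrow> 'm) set" where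
  "operators = range act \<union> dual_act ` {f. Vector_Spaces.linear scale (*) f}"

sublocale O: operator_group operators
  by unfold_locales (auto simp: operators_def A.scale_right_distrib linearD(1)[OF dual_act_linear])

lemma stable_iff_subobject: "O.stable N \<longleftrightarrow> subobject N"
proof
  assume N: "O.stable N"
  have "act h n \<in> N" if "n \<in> N" for h n
    by (rule O.stable_operator[OF N _ that]) (simp add: operators_def)
  moreover have "dual_act f n \<in> N" if "Vector_Spaces.linear scale (*) f" "n \<in> N" for f n
    by (rule O.stable_operator[OF N _ that(2)]) (simp add: operators_def that(1))
  ultimately show "subobject N"
    using O.stable_zero[OF N] O.stable_add[OF N] by (simp add: subobject_iff A.subspace_def)
next
  assume "subobject N"
  then show "O.stable N"
    unfolding O.stable_def
    by (auto simp: subobject_iff operators_def A.subspace_0 A.subspace_diff A.subspace_scale)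
qed

lemma simple_stable_iff_simple_subobject: "O.simple_stable N \<longleftrightarrow> simple_subobject N"
  by (simp add: O.simple_stable_def simple_subobject_def stable_iff_subobject)

text \<open>
  The kernel of a Yetter-Drinfeld projection onto a subobject is a complementary subobject.
\<close>

theorem direct_sum_of_simple_subobjects:
  assumes ss: "semisimple_ring TYPE('h)" and cs: "H.cosemisimple"
  obtains \<N> where "\<And>N. N \<in> \<N> \<Longrightarrow> simple_subobject N" "is_direct_sum \<N>"
proof -
  obtain t where t: "\<And>h. h * t = scale (\<epsilon> h) t" "\<epsilon> t = 1"
    using H.normalized_integral[OF ss] by blast
  obtain \<phi> where \<phi>: "Vector_Spaces.linear scale (*) \<phi>" "\<phi> 1 = 1"
    "\<And>x. H.sweedler x (\<lambda>u v. scale (\<phi> v) u) = scale (\<phi> x) 1"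
    using H.normalized_cointegral[OF cs] by blast
  interpret complemented_operator_group operators
  proof
    fix N assume "O.stable N"
    then have N: "subobject N" by (simp add: stable_iff_subobject)
    obtain P where P: "Vector_Spaces.linear scaleM scaleM P" "\<And>h m. P (act h m) = act h (P m)"
      "\<And>f m. Vector_Spaces.linear scale (*) f \<Longrightarrow> P (dual_act f m) = dual_act f (P m)"
      "\<And>m. P m \<in> N" "\<And>n. n \<in> N \<Longrightarrow> P n = n"
      using exists_yetter_drinfeld_projection[OF t \<phi> N] by blast
    let ?K = "{m. P m = 0}"
    have "subobject ?K"
      by (auto simp: subobject_iff A.subspace_def linearD(1,3)[OF P(1)] P(2,3) linearD(3)[OF dual_act_linear])
    moreover have "N \<inter> ?K = {0}"
      using P(5) linearD(3)[OF P(1)] N by (auto simp: subobject_def A.subspace_0)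
    moreover have "\<exists>n\<in>N. \<exists>k\<in>?K. x = n + k" for x
      using P(4,5) by (intro bexI[of _ "P x"] bexI[of _ "x - P x"]) (auto simp: linearD(4)[OF P(1)])
    ultimately show "\<exists>K. O.stable K \<and> N \<inter> K = {0} \<and> (\<forall>x. \<exists>n\<in>N. \<exists>k\<in>K. x = n + k)"
      unfolding stable_iff_subobject by blast
  qed
  show ?thesis
    using direct_sum_of_simple that unfolding simple_stable_iff_simple_subobject by blast
qed

end

theorem corollary3p4:
  fixes scale :: "'k::field \<Rightarrow> 'h::comm_ring_1 \<Rightarrow> 'h"
    and \<Delta> :: "'h \<Rightarrow> ('h \<times> 'h) list"
    and \<epsilon> :: "'h \<Rightarrow> 'k"
    and S :: "'h \<Rightarrow> 'h"
  assumes "hopf_algebra scale \<Delta> \<epsilon> S"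
    and "bij S"
    and "noetherian_ring TYPE('h)"
    and "semisimple_ring TYPE('h)"
    and "coalgebra.cosemisimple scale \<Delta>"
  shows "(\<forall>(scaleM :: 'k \<Rightarrow> 'm::ab_group_add \<Rightarrow> 'm) act \<rho>.
            yetter_drinfeld_module scale \<Delta> \<epsilon> S scaleM act \<rho> \<longrightarrow>
              (\<exists>\<N>. (\<forall>N\<in>\<N>. yetter_drinfeld_module.simple_subobject scale scaleM act \<rho> N \<and>
                          module.finitely_generated act N) \<and>
                    is_direct_sum \<N>) \<and>
              yetter_drinfeld_module.semisimple_object scale scaleM act \<rho>) \<and>
         yd_category_semisimple scale \<Delta> \<epsilon> S TYPE('m)"
proof -
  have main: "(\<exists>\<N>. (\<forall>N\<in>\<N>. yetter_drinfeld_module.simple_subobject scale scaleM act \<rho> N \<and>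
                          module.finitely_generated act N) \<and>
                    is_direct_sum \<N>) \<and>
              yetter_drinfeld_module.semisimple_object scale scaleM act \<rho>"
    if "yetter_drinfeld_module scale \<Delta> \<epsilon> S scaleM act \<rho>"
    for scaleM :: "'k \<Rightarrow> 'm \<Rightarrow> 'm" and act \<rho>
  proof -
    interpret yetter_drinfeld_module scale \<Delta> \<epsilon> S scaleM act \<rho> by fact
    obtain \<N> where "\<And>N. N \<in> \<N> \<Longrightarrow> simple_subobject N" "is_direct_sum \<N>"
      using direct_sum_of_simple_subobjects assms(4,5) by blast
    then show ?thesis
      unfolding semisimple_object_def using simple_subobject_finitely_generated by blast
  qed
  then show ?thesis
    unfolding yd_category_semisimple_def by blast
qed

end
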